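(* Every finite piecewise-$\ell_\infty$ cubing is an injective metric space.
   Context: **Injective spaces.** A metric space $X$ is injective if for every isometric embedding $i:A\to C$ of metric spaces and every non-expansive (1-Lipschitz) map $f:A\to X$ there is a non-expansive map $F:C\to X$ with $F\circ i=f$. **Poc sets and duals.** A poc set is a partially ordered set $(P,\le)$ with a minimum $0$ and an order-reversing involution $a\mapsto a^*$ such that $a\le a^*$ implies $a=0$. Elements other than $0,0^*$ are proper. $P$ is discrete if $\{x: a\le x\le b\}$ is finite for all proper $a,b$. An ultrafilter on $P$ is a subset $U\subseteq P$ containing exactly one of $a,a^*$ for each $a\in P$ and such that there are no $a,b\in U$ with $a\le b^*$. $P^\circ$ is the set of ultrafilters. The cube complex $\mathtt{Cube}(P)$ has vertex set $P^\circ$ and, for every $U\in P^\circ$ and every finite set $A\subseteq U$ of proper elements such that $(U\setminus A')\cup\{a^*:a\in A'\}\in P^\circ$ for all $A'\subseteq A$, a cube of dimension $|A|$ whose vertices are these $2^{|A|}$ ultrafilters. For $B\in P^\circ$, $\mathtt{Cube}(P)_B$ is the connected component containing $B$; its vertices are the $U\in P^\circ$ with $U\setminus B$ finite. **Piecewise-$\ell_\infty$ cubings.** A non-degenerate weight is a function $w:P\to[0,\infty)$ with $w(0)=0$, $w(a^* )=w(a)$ for all $a$, and $w(a)>0$ for proper $a$. Let $\rho_w(U)=w\cdot\chi_{B\setminus U}\in\mathbb{R}^B$ for vertices $U$, extended affinely to every cube (so a cube goes to an axis-parallel box), and let $\mathtt{Cube}_w(P)_B\subset\mathbb{R}^B$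 be the image of $\mathtt{Cube}(P)_B$; its faces are the images of cubes. A piecewise-$\ell_\infty$ cubing is a space of the form $\mathtt{Cube}_w(P)_B$ ($P$ a discrete poc set, $w$ a non-degenerate weight, $B\in P^\circ$) with the quotient metric: the distance from $x$ to $y$ is the infimum of $\sum_{i=1}^m\|x_i-x_{i-1}\|_\infty$ over finite sequences $x=x_0,\dots,x_m=y$ of points such that each consecutive pair lies in a common face. It is finite if $\mathtt{Cube}(P)_B$ has finitely many cubes. *)

theory Defs
  imports "HOL-Analysis.Analysis"
begin

definition nonexpansive_map ::
    "'a set \<Rightarrow> ('a \<Rightarrow> 'a \<Rightarrow> real) \<Rightarrow> 'b set \<Rightarrow> ('b \<Rightarrow> 'b \<Rightarrow> real) \<Rightarrow> ('a \<Rightarrow> 'b) \<Rightarrow> bool" where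
  "nonexpansive_map M d M' d' f \<longleftrightarrow>
     f \<in> M \<rightarrow> M' \<and> (\<forall>x\<in>M. \<forall>y\<in>M. d' (f x) (f y) \<le> d x y)"

definition isometric_embedding ::
    "'a set \<Rightarrow> ('a \<Rightarrow> 'a \<Rightarrow> real) \<Rightarrow> 'b set \<Rightarrow> ('b \<Rightarrow> 'b \<Rightarrow> real) \<Rightarrow> ('a \<Rightarrow> 'b) \<Rightarrow> bool" where
  "isometric_embedding M d M' d' i \<longleftrightarrow>
     i \<in> M \<rightarrow> M' \<and> (\<forall>x\<in>M. \<forall>y\<in>M. d' (i x) (i y) = d x y)"

text \<open>
  HOL cannot quantify over types inside a formula, so the types carrying the test spaces
  are parameters. A theorem with these type variables left free covers all metric spaces.
\<close>

definition injective_metric_space ::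
    "'a itself \<Rightarrow> 'c itself \<Rightarrow> 'x set \<Rightarrow> ('x \<Rightarrow> 'x \<Rightarrow> real) \<Rightarrow> bool" where
  "injective_metric_space TA TC X dX \<longleftrightarrow>
     Metric_space X dX \<and>
     (\<forall>(A::'a set) dA (C::'c set) dC i f.
        Metric_space A dA \<longrightarrow> Metric_space C dC \<longrightarrow>
        isometric_embedding A dA C dC i \<longrightarrow> nonexpansive_map A dA X dX f \<longrightarrow>
        (\<exists>F. nonexpansive_map C dC X dX F \<and> (\<forall>a\<in>A. F (i a) = f a)))"

locale poc_set =
  fixes P :: "'p set"
    and le :: "'p \<Rightarrow> 'p \<Rightarrow> bool" (infix \<open>\<preceq>\<close> 50)
    and zero :: 'p (\<open>\<zero>\<close>)
    and star :: "'p \<Rightarrow> 'p"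
  assumes le_refl: "reflp_on P (\<preceq>)"
    and le_antisym: "antisymp_on P (\<preceq>)"
    and le_trans: "transp_on P (\<preceq>)"
    and zero_in: "\<zero> \<in> P"
    and zero_least: "a \<in> P \<Longrightarrow> \<zero> \<preceq> a"
    and star_in: "a \<in> P \<Longrightarrow> star a \<in> P"
    and star_star: "a \<in> P \<Longrightarrow> star (star a) = a"
    and star_antimono: "\<lbrakk>a \<in> P; b \<in> P; a \<preceq> b\<rbrakk> \<Longrightarrow> star b \<preceq> star a"
    and le_star_imp_zero: "\<lbrakk>a \<in> P; a \<preceq> star a\<rbrakk> \<Longrightarrow> a = \<zero>"
begin

definition proper :: "'p \<Rightarrow> bool" where
  "proper a \<longleftrightarrow> a \<in> P \<and> a \<noteq> \<zero> \<and> a \<noteq> star \<zero>"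

definition discrete :: bool where
  "discrete \<longleftrightarrow> (\<forall>a b. proper a \<longrightarrow> proper b \<longrightarrow> finite {x \<in> P. a \<preceq> x \<and> x \<preceq> b})"

definition ultrafilter :: "'p set \<Rightarrow> bool" where
  "ultrafilter U \<longleftrightarrow>
     U \<subseteq> P \<and> (\<forall>a\<in>P. (a \<in> U) \<noteq> (star a \<in> U)) \<and> \<not> (\<exists>a\<in>U. \<exists>b\<in>U. a \<preceq> star b)"

definition flip :: "'p set \<Rightarrow> 'p set \<Rightarrow> 'p set" where
  "flip U A = (U - A) \<union> star ` A"

definition spans_cube :: "'p set \<Rightarrow> 'p set \<Rightarrow> bool" where
  "spans_cube U A \<longleftrightarrow>
     ultrafilter U \<and> A \<subseteq> U \<and> finite A \<and> (\<forall>a\<in>A. proper a) \<and>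
     (\<forall>A'\<subseteq>A. ultrafilter (flip U A'))"

definition cube_vertices :: "'p set \<Rightarrow> 'p set \<Rightarrow> 'p set set" where
  "cube_vertices U A = flip U ` Pow A"

definition cube_adjacent :: "'p set \<Rightarrow> 'p set \<Rightarrow> bool" where
  "cube_adjacent V W \<longleftrightarrow>
     (\<exists>U A. spans_cube U A \<and> V \<in> cube_vertices U A \<and> W \<in> cube_vertices U A)"

text \<open>Vertices of the connected component of \<open>B\<close>; compare \<open>component_eq\<close> below.\<close>

definition component :: "'p set \<Rightarrow> 'p set set" where
  "component B = {U. cube_adjacent\<^sup>*\<^sup>* B U}"

text \<open>
  The same cube is spanned from each of its vertices, so cubes are identified with their
  vertex sets.
\<close>

definition cubes :: "'p set \<Rightarrow> 'p set set set" where
  "cubes B = {cube_vertices U A | U A. spans_cube U A \<and> U \<in> component B}"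

definition nondegenerate_weight :: "('p \<Rightarrow> real) \<Rightarrow> bool" where
  "nondegenerate_weight w \<longleftrightarrow>
     (\<forall>a\<in>P. 0 \<le> w a) \<and> w \<zero> = 0 \<and> (\<forall>a\<in>P. w (star a) = w a) \<and>
     (\<forall>a. proper a \<longrightarrow> 0 < w a)"

text \<open>
  The space $\mathbb{R}^B$ is encoded as the functions that vanish off \<open>B\<close>.
\<close>

definition vertex_point :: "('p \<Rightarrow> real) \<Rightarrow> 'p set \<Rightarrow> 'p set \<Rightarrow> 'p \<Rightarrow> real" where
  "vertex_point w B U = (\<lambda>p. w p * indicator (B - U) p)"

text \<open>
  The affine map on the unit cube $[0,1]^A$ that takes the origin to the image of \<open>U\<close> and
  the unit vector at \<open>a\<close> to the image of \<open>flip U {a}\<close>. It takes every other vertex to the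
  correct image as well, see \<open>affine_extension_vertex\<close>.
\<close>

definition affine_extension ::
    "('p \<Rightarrow> real) \<Rightarrow> 'p set \<Rightarrow> 'p set \<Rightarrow> 'p set \<Rightarrow> ('p \<Rightarrow> real) \<Rightarrow> 'p \<Rightarrow> real" where
  "affine_extension w B U A t =
     (\<lambda>p. vertex_point w B U p +
        (\<Sum>a\<in>A. t a * (vertex_point w B (flip U {a}) p - vertex_point w B U p)))"

definition face :: "('p \<Rightarrow> real) \<Rightarrow> 'p set \<Rightarrow> 'p set \<Rightarrow> 'p set \<Rightarrow> ('p \<Rightarrow> real) set" where
  "face w B U A = affine_extension w B U A ` (A \<rightarrow> {0..1})"

definition faces :: "('p \<Rightarrow> real) \<Rightarrow> 'p set \<Rightarrow> ('p \<Rightarrow> real) set set" where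
  "faces w B = {face w B U A | U A. spans_cube U A \<and> U \<in> component B}"

definition cubing :: "('p \<Rightarrow> real) \<Rightarrow> 'p set \<Rightarrow> ('p \<Rightarrow> real) set" where
  "cubing w B = \<Union> (faces w B)"

definition linf_dist :: "'p set \<Rightarrow> ('p \<Rightarrow> real) \<Rightarrow> ('p \<Rightarrow> real) \<Rightarrow> real" where
  "linf_dist B x y = (SUP p\<in>B. \<bar>x p - y p\<bar>)"

definition chain_lengths ::
    "('p \<Rightarrow> real) \<Rightarrow> 'p set \<Rightarrow> ('p \<Rightarrow> real) \<Rightarrow> ('p \<Rightarrow> real) \<Rightarrow> real set" where
  "chain_lengths w B x y =
     {\<Sum>i=1..m. linf_dist B (c i) (c (i - 1)) | (m::nat) c.
        c 0 = x \<and> c m = y \<and>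
        (\<forall>i\<in>{1..m}. \<exists>F\<in>faces w B. c (i - 1) \<in> F \<and> c i \<in> F)}"

text \<open>
  \<open>Metric_space\<close> asks for nonnegativity and symmetry on the whole type, hence the value 0
  off the cubing (where \<open>Inf\<close> of the empty set of reals would be unspecified).
\<close>

definition cubing_dist ::
    "('p \<Rightarrow> real) \<Rightarrow> 'p set \<Rightarrow> ('p \<Rightarrow> real) \<Rightarrow> ('p \<Rightarrow> real) \<Rightarrow> real" where
  "cubing_dist w B x y =
     (if x \<in> cubing w B \<and> y \<in> cubing w B then Inf (chain_lengths w B x y) else 0)"

lemma flip_empty [simp]: "flip U {} = U"
  by (simp add: flip_def)

lemma ultrafilter_upclosed:
  assumes "ultrafilter U" "a \<in> U" "b \<in> P" "a \<preceq> b"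
  shows "b \<in> U"
proof (rule ccontr)
  assume "b \<notin> U"
  then have "star b \<in> U" using assms unfolding ultrafilter_def by blast
  moreover have "a \<preceq> star (star b)" using assms star_star by simp
  ultimately show False using assms unfolding ultrafilter_def by blast
qed

lemma zero_notin_ultrafilter: "ultrafilter U \<Longrightarrow> \<zero> \<notin> U"
  unfolding ultrafilter_def using zero_least zero_in star_in by blast

lemma star_zero_in_ultrafilter: "ultrafilter U \<Longrightarrow> star \<zero> \<in> U"
  using zero_notin_ultrafilter zero_in unfolding ultrafilter_def by blast

lemma adjacent_finite_diff:
  assumes "cube_adjacent V W" shows "ultrafilter W \<and> finite (W - V)"
proof -
  obtain U A X Y where *: "spans_cube U A" "X \<subseteq> A" "Y \<subseteq> A" "V = flip U X" "W = flip U Y"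
    using assms unfolding cube_adjacent_def cube_vertices_def by blast
  have "W - V \<subseteq> A \<union> star ` A" using * unfolding flip_def by blast
  moreover have "finite A" "ultrafilter W" using * unfolding spans_cube_def by auto
  ultimately show ?thesis by (meson finite_UnI finite_imageI finite_subset)
qed

lemma ultrafilter_flip_minimal:
  assumes U: "ultrafilter U" and a: "a \<in> U"
    and min: "\<And>b. b \<in> U \<Longrightarrow> b \<preceq> a \<Longrightarrow> b = a"
    and ne: "a \<noteq> star \<zero>"
  shows "ultrafilter (flip U {a})"
proof -
  have UP: "U \<subseteq> P" and ex: "\<And>x. x \<in> P \<Longrightarrow> (x \<in> U) \<noteq> (star x \<in> U)"
    and co: "\<And>x y. x \<in> U \<Longrightarrow> y \<in> U \<Longrightarrow> \<not> x \<preceq> star y"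
    using U unfolding ultrafilter_def by blast+
  have aP: "a \<in> P" using a UP by blast
  have nsa: "star a \<notin> U" using ex[OF aP] a by blast
  have inj: "star x = star y \<Longrightarrow> x = y" if "x \<in> P" "y \<in> P" for x y
    using star_star that by metis
  have mem: "x \<in> flip U {a} \<longleftrightarrow> (x \<in> U \<and> x \<noteq> a) \<or> x = star a" for x
    by (auto simp: flip_def)
  have 1: "flip U {a} \<subseteq> P" using UP star_in[OF aP] by (auto simp: flip_def)
  have 2: "(x \<in> flip U {a}) \<noteq> (star x \<in> flip U {a})" if x: "x \<in> P" for x
  proof -
    have ns: "a \<noteq> star a" using a nsa by auto
    consider "x = a" | "x = star a" | "x \<noteq> a" "x \<noteq> star a" by blast
    then show ?thesis
    proof cases
      case 1 then show ?thesis unfolding mem using ns by simp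
    next
      case 2 then show ?thesis unfolding mem using ns star_star[OF aP] by simp
    next
      case 3
      then have "star x \<noteq> star a" using inj[OF x aP] by blast
      moreover have "star x \<noteq> a" using 3(2) star_star[OF x] by auto
      ultimately show ?thesis unfolding mem using 3 ex[OF x] by blast
    qed
  qed
  have 3: "\<not> x \<preceq> star y" if xy: "x \<in> flip U {a}" "y \<in> flip U {a}" for x y
  proof
    assume le: "x \<preceq> star y"
    have xP: "x \<in> P" and yP: "y \<in> P" using xy 1 by auto
    consider "x \<in> U" "y \<in> U" | "x \<in> U" "x \<noteq> a" "y = star a" | "x = star a" "y \<in> U" "y \<noteq> a"
      | "x = star a" "y = star a" using xy unfolding mem by blast
    then show False
    proof cases
      case 1 then show ?thesis using co le by blast
    next
      case 2
      then have "x \<preceq> a" using le star_star[OF aP] by simp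
      then show ?thesis using 2 min by blast
    next
      case 3
      have "star (star y) \<preceq> star (star a)"
        using star_antimono[OF xP star_in[OF yP] le] 3 by simp
      then have "y \<preceq> a" using star_star[OF aP] star_star[OF yP] by simp
      then show ?thesis using 3 min by blast
    next
      case 4
      then have "star a = \<zero>" using le le_star_imp_zero star_in[OF aP] by blast
      then show ?thesis using ne star_star[OF aP] by simp
    qed
  qed
  show ?thesis unfolding ultrafilter_def using 1 2 3 by blast
qed

lemma cube_adjacent_sym: "cube_adjacent V W \<Longrightarrow> cube_adjacent W V"
  unfolding cube_adjacent_def by blast

lemma component_eq:
  assumes B: "ultrafilter B"
  shows "component B = {U. ultrafilter U \<and> finite (U - B)}"
proof (intro set_eqI iffI)
  fix U assume "U \<in> component B"
  then have "cube_adjacent\<^sup>*\<^sup>* B U" by (simp add: component_def)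
  then have "ultrafilter U \<and> finite (U - B)"
  proof induction
    case base then show ?case using B by simp
  next
    case (step V W)
    have "W - B \<subseteq> (W - V) \<union> (V - B)" by blast
    then show ?case using step adjacent_finite_diff
      by (meson finite_UnI finite_subset)
  qed
  then show "U \<in> {U. ultrafilter U \<and> finite (U - B)}" by simp
next
  fix U assume "U \<in> {U. ultrafilter U \<and> finite (U - B)}"
  then have "ultrafilter U" "finite (U - B)" by auto
  then have "cube_adjacent\<^sup>*\<^sup>* B U"
  proof (induction "card (U - B)" arbitrary: U rule: less_induct)
    case less
    have UP: "U \<subseteq> P" and BP: "B \<subseteq> P" using less.prems B unfolding ultrafilter_def by blast+
    show ?case
    proof (cases "U - B = {}")
      case True
      then have "U = B" using less.prems(1) B BP unfolding ultrafilter_def by blast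
      then show ?thesis by simp
    next
      case False
      define r where "r x y \<longleftrightarrow> x \<preceq> y \<and> x \<noteq> y" for x y
      have "asymp_on (U - B) r"
        unfolding r_def using le_antisym UP by (auto simp: asymp_on_def antisymp_on_def)
      moreover have "transp_on (U - B) r"
        unfolding r_def transp_on_def
        using antisymp_onD[OF le_antisym] transp_onD[OF le_trans] UP by (metis DiffD1 in_mono)
      ultimately obtain a where a: "a \<in> U - B" and m: "\<And>x. x \<in> U - B \<Longrightarrow> \<not> r x a"
        using Finite_Set.bex_min_element[of "U - B" r] less.prems(2) False
        by (metis r_def)
      have aP: "a \<in> P" using a UP by blast
      have min: "b = a" if "b \<in> U" "b \<preceq> a" for b
        using that m[of b] ultrafilter_upclosed[OF B _ aP that(2)] a unfolding r_def by blast
      have ne: "a \<noteq> star \<zero>" using a star_zero_in_ultrafilter[OF B] by blast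
      have nz: "a \<noteq> \<zero>" using a zero_notin_ultrafilter[OF less.prems(1)] by blast
      let ?V = "flip U {a}"
      have V: "ultrafilter ?V"
        using ultrafilter_flip_minimal[OF less.prems(1) _ min ne] a by blast
      have "star a \<in> B" using a aP B unfolding ultrafilter_def by blast
      then have VB: "?V - B = (U - B) - {a}" by (auto simp: flip_def)
      have "card (?V - B) < card (U - B)"
        unfolding VB using a less.prems(2) by (meson card_Diff1_less)
      moreover have "finite (?V - B)" unfolding VB using less.prems(2) by simp
      ultimately have "cube_adjacent\<^sup>*\<^sup>* B ?V" using less.hyps V by blast
      moreover have "spans_cube U {a}"
        unfolding spans_cube_def proper_def
        using less.prems(1) a aP ne nz V by (auto simp: subset_singleton_iff)
      then have "cube_adjacent ?V U"
        unfolding cube_adjacent_def cube_vertices_def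
        by (intro exI[of _ U] exI[of _ "{a}"]) (auto simp: image_iff intro: bexI[of _ "{}"])
      ultimately show ?thesis by (rule rtranclp.rtrancl_into_rtrancl)
    qed
  qed
  then show "U \<in> component B" by (simp add: component_def)
qed

lemma affine_extension_vertex:
  assumes B: "ultrafilter B" and c: "spans_cube U A" and A': "A' \<subseteq> A"
  shows "affine_extension w B U A (indicator A') = vertex_point w B (flip U A')"
proof
  fix p
  have U: "ultrafilter U" and AU: "A \<subseteq> U" and fin: "finite A"
    using c unfolding spans_cube_def by auto
  have UP: "U \<subseteq> P" and ex: "\<And>x. x \<in> P \<Longrightarrow> (x \<in> U) \<noteq> (star x \<in> U)"
    using U unfolding ultrafilter_def by blast+
  show "affine_extension w B U A (indicator A') p = vertex_point w B (flip U A') p"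
  proof (cases "p \<in> B")
    case False
    then show ?thesis by (simp add: affine_extension_def vertex_point_def)
  next
    case True
    then have pP: "p \<in> P" using B unfolding ultrafilter_def by blast
    have st: "p = star a \<longleftrightarrow> a = star p" if "a \<in> A" for a
      using star_star pP that AU UP by (metis subsetD)
    have mem: "p \<in> flip U X \<longleftrightarrow> (p \<in> U \<and> p \<notin> X) \<or> star p \<in> X" if "X \<subseteq> A" for X
    proof -
      have "p \<in> star ` X \<longleftrightarrow> (\<exists>a\<in>X. p = star a)"
        by (simp only: image_iff)
      also have "\<dots> \<longleftrightarrow> (\<exists>a\<in>X. a = star p)"
        using st subsetD[OF that] by (intro bex_cong) simp_all
      finally show ?thesis by (simp add: flip_def)
    qed
    define q where "q = (if p \<in> U then p else star p)"
    define s :: real where "s = (if p \<in> U then 1 else -1)"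
    have d: "vertex_point w B (flip U X) p - vertex_point w B U p
               = w p * s * indicator X q" if "X \<subseteq> A" for X
      using True ex[OF pP] mem[OF that] AU that
      by (auto simp: vertex_point_def q_def s_def indicator_def)
    have "(\<Sum>a\<in>A. indicator A' a * (vertex_point w B (flip U {a}) p - vertex_point w B U p))
        = (\<Sum>a\<in>A. if a = q then indicator A' q * (w p * s) else 0)"
      by (intro sum.cong) (auto simp: d indicator_def)
    also have "\<dots> = w p * s * indicator A' q"
      using fin A' by (auto simp: sum.delta indicator_def)
    also have "\<dots> = vertex_point w B (flip U A') p - vertex_point w B U p"
      using d[OF A'] by simp
    finally show ?thesis by (simp add: affine_extension_def)
  qed
qed

end

locale piecewise_linf_cubing = poc_set +
  fixes w :: "'a \<Rightarrow> real" and B :: "'a set"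
  assumes discrete: "discrete"
    and weight: "nondegenerate_weight w"
    and base: "ultrafilter B"

locale finite_piecewise_linf_cubing = piecewise_linf_cubing +
  assumes finite_cubes: "finite (cubes B)"

end

theory Submission
  imports Defs
begin

text \<open>
  An element \<open>p\<close> of \<open>B\<close> is a wall, and the coordinate \<open>x p\<close> of a point \<open>x\<close> says how far \<open>x\<close> has
  moved across that wall, away from \<open>B\<close>. Two kinds of pairs of walls constrain the coordinates. If
  \<open>p \<preceq> q\<close>, the wall \<open>q\<close> lies behind \<open>p\<close> as seen from \<open>B\<close>, and \<open>p\<close> must be crossed completely before
  \<open>q\<close> is entered. If \<open>star p \<preceq> q\<close>, the far sides of \<open>p\<close> and \<open>q\<close> are disjoint, and at most one of the
  two walls can be entered. The cubing consists of exactly the finitely supported vectors with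
  coordinates between \<open>0\<close> and \<open>w p\<close> that satisfy these pairwise conditions (\<open>mem_cubing_iff\<close>).

  The proof replaces the coordinate \<open>x p\<close>, which cannot exceed \<open>w p\<close>, by the depth of \<open>x\<close> behind
  \<open>p\<close>: the distance from \<open>x\<close> to the points whose coordinate at \<open>p\<close> is \<open>0\<close>. It is the largest sum of
  coordinates of \<open>x\<close> over a chain of walls that are equal to \<open>p\<close> or behind it, and clipping it to
  the range from \<open>0\<close> to \<open>w p\<close> gives \<open>x p\<close> back (\<open>clip_depth\<close>). Two facts make depths useful.

  First, chains of points bound differences of depths. Two nested walls cannot both be in motion
  inside one face, so each depth is 1-Lipschitz on a face for the sup norm. Likewise, if \<open>star p \<preceq> q\<close>,
  a chain from a point behind \<open>p\<close> to a point behind \<open>q\<close> has to undo the depth behind \<open>p\<close> before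
  it can build up depth behind \<open>q\<close>, so its length is at least the sum of the two depths
  (\<open>profiles_within_chain_length\<close>).

  Second, these bounds are the only obstruction to the existence of short chains. Call a family of
  reals a profile if it behaves like a family of depths under nesting of walls. Two profiles \<open>u\<close> and \<open>v\<close>
  that satisfy the bounds above with the number \<open>e\<close> are joined by the profiles
  \<open>max (u - t) (v - (e - t))\<close>, where \<open>t\<close> runs from \<open>0\<close> to \<open>e\<close>. Clipping turns these into a path in the
  cubing whose coordinates are all 1-Lipschitz, hence a path of length at most \<open>e\<close>
  (\<open>short_chain_between_clips\<close>).

  A nonexpansive map \<open>f\<close> on a subspace \<open>A\<close> of \<open>C\<close> is now extended by McShane's formula applied to
  depths: \<open>c\<close> is sent to the clipping of the profile whose value at \<open>p\<close> is the supremum over \<open>a\<close> in \<open>A\<close>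
  of the depth of \<open>f a\<close> behind \<open>p\<close> minus the distance from \<open>a\<close> to \<open>c\<close>. Geometrically, this is a
  point nearest to \<open>B\<close> in the intersection of the balls around the points \<open>f a\<close> that the image of \<open>c\<close>
  must belong to. The bounds between the profiles of two points of \<open>C\<close> follow from the bounds between
  depths, so the extension is nonexpansive (\<open>nonexpansive_extension\<close>).
\<close>

section \<open>Points of the cubing as coordinate vectors\<close>

context piecewise_linf_cubing
begin

text \<open>
  The last two conditions are the nesting and the disjointness of far sides described above. Inside
  \<open>B\<close> these are the only relations between two walls, as \<open>p \<preceq> star q\<close> is excluded for an ultrafilter.
\<close>

definition cubing_point :: "('a \<Rightarrow> real) \<Rightarrow> bool" where
  "cubing_point x \<longleftrightarrow>
     finite {p. x p \<noteq> 0} \<and> (\<forall>p. p \<notin> B \<longrightarrow> x p = 0) \<and> (\<forall>p\<in>B. 0 \<le> x p \<and> x p \<le> w p) \<and>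
     (\<forall>p\<in>B. \<forall>q\<in>B. p \<preceq> q \<longrightarrow> p \<noteq> q \<longrightarrow> 0 < x q \<longrightarrow> x p = w p) \<and>
     (\<forall>p\<in>B. \<forall>q\<in>B. star p \<preceq> q \<longrightarrow> x p = 0 \<or> x q = 0)"

lemma cubing_pointD:
  assumes "cubing_point x"
  shows cubing_point_finite: "finite {p. x p \<noteq> 0}"
    and cubing_point_off: "p \<notin> B \<Longrightarrow> x p = 0"
    and cubing_point_nonneg: "0 \<le> x p"
    and cubing_point_le: "p \<in> B \<Longrightarrow> x p \<le> w p"
    and cubing_point_nested: "\<lbrakk>p \<in> B; q \<in> B; p \<preceq> q; p \<noteq> q; 0 < x q\<rbrakk> \<Longrightarrow> x p = w p"
    and cubing_point_exclusive: "\<lbrakk>p \<in> B; q \<in> B; star p \<preceq> q\<rbrakk> \<Longrightarrow> x p = 0 \<or> x q = 0"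
proof -
  note c = assms[unfolded cubing_point_def]
  show "finite {p. x p \<noteq> 0}" "p \<notin> B \<Longrightarrow> x p = 0" "p \<in> B \<Longrightarrow> x p \<le> w p"
    "\<lbrakk>p \<in> B; q \<in> B; star p \<preceq> q\<rbrakk> \<Longrightarrow> x p = 0 \<or> x q = 0"
    "\<lbrakk>p \<in> B; q \<in> B; p \<preceq> q; p \<noteq> q; 0 < x q\<rbrakk> \<Longrightarrow> x p = w p"
    using c by simp_all
  show "0 \<le> x p" using c by (cases "p \<in> B") auto
qed

lemma B_subset: "B \<subseteq> P"
  using base unfolding ultrafilter_def by blast

lemma B_in_P: "p \<in> B \<Longrightarrow> p \<in> P"
  using B_subset by blast

lemma star_notin_B: "p \<in> B \<Longrightarrow> star p \<notin> B"
  using base B_in_P unfolding ultrafilter_def by blast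

lemma B_consistent: "p \<in> B \<Longrightarrow> q \<in> B \<Longrightarrow> \<not> p \<preceq> star q"
  using base unfolding ultrafilter_def by blast

lemma B_neq_star: "p \<in> B \<Longrightarrow> q \<in> B \<Longrightarrow> p \<noteq> star q"
  using star_notin_B by blast

lemma weight_zero_star: "w (star \<zero>) = 0"
  using weight zero_in unfolding nondegenerate_weight_def by auto

lemma weight_nonneg: "p \<in> B \<Longrightarrow> 0 \<le> w p"
  using weight B_in_P unfolding nondegenerate_weight_def by auto

lemma proper_iff_weight_pos: "p \<in> B \<Longrightarrow> proper p \<longleftrightarrow> 0 < w p"
  using weight B_in_P zero_notin_ultrafilter[OF base] weight_zero_star
  unfolding nondegenerate_weight_def proper_def by (metis less_irrefl)

text \<open>
  The only element of \<open>B\<close> of weight \<open>0\<close> is \<open>star \<zero>\<close>, and nothing else is above it.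
\<close>

lemma weight_pos_below:
  assumes "p \<in> B" "q \<in> B" "p \<preceq> q" "0 < w q"
  shows "0 < w p"
proof (rule ccontr)
  assume "\<not> 0 < w p"
  then have p: "p = star \<zero>"
    using proper_iff_weight_pos[OF assms(1)] assms(1) B_in_P zero_notin_ultrafilter[OF base]
    unfolding proper_def by blast
  have "star q \<preceq> star (star \<zero>)"
    using star_antimono assms B_in_P p by blast
  then have "star q = \<zero>"
    using star_star[OF zero_in] zero_least star_in assms(2) B_in_P zero_in
      antisymp_onD[OF le_antisym] by metis
  then have "q = star \<zero>" using star_star assms(2) B_in_P by metis
  then show False using weight_zero_star assms(4) by simp
qed

lemma star_le_commute: "p \<in> B \<Longrightarrow> q \<in> B \<Longrightarrow> star p \<preceq> q \<Longrightarrow> star q \<preceq> p"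
  using star_antimono[of "star p" q] star_in star_star B_in_P by metis

lemma mem_flip_base:
  assumes "T \<subseteq> B" "x \<in> P"
  shows "x \<in> flip B T \<longleftrightarrow> (x \<in> B \<and> x \<notin> T) \<or> star x \<in> T"
proof -
  have "x \<in> star ` T \<longleftrightarrow> star x \<in> T"
    using star_star assms B_in_P by (metis image_iff subsetD)
  then show ?thesis unfolding flip_def by blast
qed

text \<open>
  The two hypotheses are the combinatorial form of the two conditions on coordinates: the walls that a
  vertex has crossed are closed under passing to walls nearer to \<open>B\<close>, and no two of them have disjoint
  far sides.
\<close>

lemma ultrafilter_flip_base:
  assumes TB: "T \<subseteq> B"
    and down: "\<And>p q. p \<in> B \<Longrightarrow> q \<in> T \<Longrightarrow> p \<preceq> q \<Longrightarrow> p \<in> T"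
    and excl: "\<And>p q. p \<in> T \<Longrightarrow> q \<in> T \<Longrightarrow> \<not> star p \<preceq> q"
  shows "ultrafilter (flip B T)"
proof -
  have sub: "flip B T \<subseteq> P"
    using TB B_in_P star_in unfolding flip_def by blast
  have one: "(x \<in> flip B T) \<noteq> (star x \<in> flip B T)" if x: "x \<in> P" for x
  proof (cases "x \<in> B")
    case True
    then show ?thesis
      using mem_flip_base[OF TB] x star_in star_star star_notin_B TB by (metis subsetD)
  next
    case False
    then have "star x \<in> B" using base x unfolding ultrafilter_def by blast
    then show ?thesis
      using mem_flip_base[OF TB] x star_in star_star False TB by (metis subsetD)
  qed
  have con: "\<not> x \<preceq> star y" if "x \<in> flip B T" "y \<in> flip B T" for x y
  proof
    assume le: "x \<preceq> star y"
    have x: "x \<in> B - T \<or> (\<exists>p. p \<in> T \<and> x = star p)" and y: "y \<in> B - T \<or> (\<exists>q. q \<in> T \<and> y = star q)"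
      using that unfolding flip_def by blast+
    consider "x \<in> B" "y \<in> B" | q where "x \<in> B - T" "q \<in> T" "y = star q"
      | p where "p \<in> T" "x = star p" "y \<in> B - T" | p q where "p \<in> T" "q \<in> T" "x = star p" "y = star q"
      using x y by blast
    then show False
    proof cases
      case 1
      then show ?thesis using le B_consistent by blast
    next
      case 2
      then show ?thesis using le down star_star TB B_in_P by (metis DiffD1 DiffD2 subsetD)
    next
      case 3
      then have "y \<preceq> p"
        using star_antimono[of "star p" "star y"] le star_in star_star TB B_in_P
        by (metis DiffD1 subsetD)
      then show ?thesis using 3 down by blast
    next
      case 4
      then show ?thesis using le excl star_star TB B_in_P by (metis subsetD)
    qed
  qed
  show ?thesis unfolding ultrafilter_def using sub one con by blast
qed

lemma affine_extension_coords:
  assumes c: "spans_cube U A" and p: "p \<in> B"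
  shows "affine_extension w B U A t p =
    (if p \<in> A then t p * w p else if star p \<in> A then (1 - t (star p)) * w p
     else if p \<in> U then 0 else w p)"
proof -
  have U: "ultrafilter U" and AU: "A \<subseteq> U" and fin: "finite A"
    using c unfolding spans_cube_def by auto
  have UP: "U \<subseteq> P" and ex: "\<And>x. x \<in> P \<Longrightarrow> (x \<in> U) \<noteq> (star x \<in> U)"
    using U unfolding ultrafilter_def by blast+
  have pP: "p \<in> P" using p B_in_P by blast
  have mem: "p \<in> flip U {a} \<longleftrightarrow> (p \<in> U \<and> p \<noteq> a) \<or> star p = a" if "a \<in> A" for a
    using star_star pP that AU UP unfolding flip_def by auto
  define q where "q = (if p \<in> U then p else star p)"
  define s :: real where "s = (if p \<in> U then w p else - w p)"
  have d: "vertex_point w B (flip U {a}) p - vertex_point w B U p = (if a = q then s else 0)"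
    if "a \<in> A" for a
    using p ex[OF pP] mem[OF that] AU that
    by (auto simp: vertex_point_def q_def s_def)
  have "affine_extension w B U A t p = vertex_point w B U p + (\<Sum>a\<in>A. if a = q then t q * s else 0)"
    unfolding affine_extension_def by (intro arg_cong2[of _ _ _ _ "(+)"] sum.cong) (auto simp: d)
  also have "\<dots> = vertex_point w B U p + (if q \<in> A then t q * s else 0)"
    using fin by simp
  finally show ?thesis
    using p ex[OF pP] AU by (auto simp: vertex_point_def q_def s_def algebra_simps)
qed

lemma affine_extension_off_base: "p \<notin> B \<Longrightarrow> affine_extension w B U A t p = 0"
  by (simp add: affine_extension_def vertex_point_def)

lemma finite_base_diff:
  assumes "U \<in> component B"
  shows "finite (B - U)"
proof -
  have U: "ultrafilter U" "finite (U - B)" using assms component_eq[OF base] by auto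
  have "B - U \<subseteq> star ` (U - B)"
  proof
    fix p assume p: "p \<in> B - U"
    then have "star p \<in> U" "star p \<notin> B" using U B_in_P star_notin_B unfolding ultrafilter_def by blast+
    then show "p \<in> star ` (U - B)" using p star_star B_in_P by (metis DiffD1 DiffI image_eqI)
  qed
  then show ?thesis using U finite_subset by blast
qed

text \<open>
  A violated condition on a pair of coordinates would be violated at some vertex of the face as well,
  since each of the two coordinates can be pushed to an end of its range independently of the other.
\<close>

lemma face_subset_cubing_point:
  assumes F: "F \<in> faces w B" and x: "x \<in> F"
  shows "cubing_point x"
proof -
  obtain U A t where c: "spans_cube U A" "U \<in> component B" and t: "t \<in> A \<rightarrow> {0..1}"
    and xt: "x = affine_extension w B U A t"
    using F x unfolding faces_def face_def by blast
  have U: "ultrafilter U" and AU: "A \<subseteq> U" and fin: "finite A"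
    and fl: "\<And>A'. A' \<subseteq> A \<Longrightarrow> ultrafilter (flip U A')"
    using c unfolding spans_cube_def by auto
  have UP: "U \<subseteq> P" and ex: "\<And>x. x \<in> P \<Longrightarrow> (x \<in> U) \<noteq> (star x \<in> U)"
    using U unfolding ultrafilter_def by blast+
  note co = affine_extension_coords[OF c(1), of _ t, folded xt]
  have t01: "a \<in> A \<Longrightarrow> 0 \<le> t a \<and> t a \<le> 1" for a using t by (auto simp: Pi_iff)
  have off: "x p = 0" if "p \<notin> B" for p using that xt affine_extension_off_base by simp
  have bd: "0 \<le> x p \<and> x p \<le> w p" if p: "p \<in> B" for p
    using co[OF p] weight_nonneg[OF p] t01 by (auto intro!: mult_left_le_one_le)
  have mem: "p \<in> flip U X \<longleftrightarrow> (p \<in> U \<and> p \<notin> X) \<or> star p \<in> X" if "X \<subseteq> A" "p \<in> P" for X p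
    using star_star that AU UP unfolding flip_def by (auto simp: image_iff) (metis subsetD)+
  have "{p. x p \<noteq> 0} \<subseteq> A \<union> star ` A \<union> (B - U)"
  proof
    fix p assume "p \<in> {p. x p \<noteq> 0}"
    then have p: "p \<in> B" "x p \<noteq> 0" using off by auto
    then have "p \<in> A \<or> star p \<in> A \<or> p \<notin> U" using co by (auto split: if_splits)
    then show "p \<in> A \<union> star ` A \<union> (B - U)"
      using p star_star[OF B_in_P] by (metis DiffI UnCI image_eqI)
  qed
  then have supp: "finite {p. x p \<noteq> 0}"
    using finite_base_diff[OF c(2)] fin by (meson finite_UnI finite_imageI finite_subset)
  have away: "q \<notin> U \<or> q \<in> A" if "q \<in> B" "x q \<noteq> 0" for q
    using co[OF that(1)] that ex[OF B_in_P[OF that(1)]] AU by (auto split: if_splits)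
  have near: "p \<in> U \<or> star p \<in> A" if "p \<in> B" "x p \<noteq> w p" for p
    using co[OF that(1)] that AU by (auto split: if_splits)
  have nest: "x p = w p" if pq: "p \<in> B" "q \<in> B" "p \<preceq> q" "p \<noteq> q" "0 < x q" for p q
  proof (rule ccontr)
    assume ne: "x p \<noteq> w p"
    \<comment> \<open>the vertex of the cube that is turned at the wall of \<open>q\<close> only away from \<open>B\<close>, and at the wall of
      \<open>p\<close> only towards \<open>B\<close>\<close>
    let ?X = "A \<inter> {q, star p}"
    have V: "ultrafilter (flip U ?X)" using fl by blast
    have d: "star p \<noteq> p" "star q \<noteq> q" "star p \<noteq> q" "star q \<noteq> p" "star p \<noteq> star q"
      using pq(1,2,4) B_neq_star star_star[OF B_in_P] by metis+
    have "p \<notin> ?X" using pq(4) d(1) by auto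
    then have "p \<in> flip U ?X"
      using near[OF pq(1) ne] mem[of ?X p] pq(1) B_in_P by blast
    moreover have "star q \<notin> ?X" using d(2,5) by auto
    then have "q \<notin> flip U ?X"
      using away[OF pq(2)] pq(5) mem[of ?X q] pq(2) B_in_P by auto
    ultimately show False using ultrafilter_upclosed[OF V _ _ pq(3)] pq(2) B_in_P by blast
  qed
  have excl: "x p = 0 \<or> x q = 0" if pq: "p \<in> B" "q \<in> B" "star p \<preceq> q" for p q
  proof (rule ccontr)
    assume ne: "\<not> (x p = 0 \<or> x q = 0)"
    let ?X = "A \<inter> {p, q}"
    have V: "ultrafilter (flip U ?X)" using fl by blast
    have d: "star p \<notin> ?X" "star q \<notin> ?X"
      using star_notin_B[OF pq(1)] star_notin_B[OF pq(2)] pq(1,2) by auto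
    have "p \<notin> flip U ?X"
      using away[OF pq(1)] ne mem[of ?X p] pq(1) B_in_P d(1) by blast
    then have "star p \<in> flip U ?X" using V pq B_in_P unfolding ultrafilter_def by blast
    moreover have "q \<notin> flip U ?X"
      using away[OF pq(2)] ne mem[of ?X q] pq(2) B_in_P d(2) by blast
    ultimately show False using ultrafilter_upclosed[OF V _ _ pq(3)] pq(2) B_in_P by blast
  qed
  show ?thesis unfolding cubing_point_def using supp off bd nest excl by blast
qed

text \<open>
  The face is the one that contains \<open>y\<close> in its relative interior: its free coordinates are those with
  \<open>0 < y p < w p\<close>, and its vertices are \<open>flip B (V \<union> A')\<close>, where \<open>V\<close> is the set of walls fully crossed
  by \<open>y\<close> and \<open>A'\<close> is any set of free coordinates. The last two hypotheses say that \<open>x\<close> agrees with \<open>y\<close>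
  in the fixed coordinates.
\<close>

lemma common_face:
  assumes x: "cubing_point x" and y: "cubing_point y"
    and zero: "\<And>p. y p = 0 \<Longrightarrow> x p = 0" and full: "\<And>p. p \<in> B \<Longrightarrow> y p = w p \<Longrightarrow> x p = w p"
  shows "\<exists>F\<in>faces w B. x \<in> F \<and> y \<in> F"
proof -
  have yB: "y p \<noteq> 0 \<Longrightarrow> p \<in> B" and ybd: "p \<in> B \<Longrightarrow> 0 \<le> y p \<and> y p \<le> w p" for p
    using cubing_pointD(2-4)[OF y] by blast+
  note ynest = cubing_point_nested[OF y] and yex = cubing_point_exclusive[OF y]
    and yfin = cubing_point_finite[OF y]
  define V where "V = {p. y p \<noteq> 0 \<and> y p = w p}"
  define A where "A = {p. y p \<noteq> 0 \<and> y p < w p}"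
  define U where "U = flip B V"
  have VB: "V \<subseteq> B" and AB: "A \<subseteq> B" using yB unfolding V_def A_def by blast+
  have finA: "finite A" and finV: "finite V"
    using yfin unfolding A_def V_def by (auto elim: finite_subset[rotated])
  have uf: "ultrafilter (flip B (V \<union> A'))" if A': "A' \<subseteq> A" for A'
  proof (rule ultrafilter_flip_base)
    show "V \<union> A' \<subseteq> B" using VB AB A' by blast
    show "p \<in> V \<union> A'" if pq: "p \<in> B" "q \<in> V \<union> A'" "p \<preceq> q" for p q
    proof (cases "p = q")
      case True then show ?thesis using pq by simp
    next
      case False
      have q: "q \<in> B" "y q \<noteq> 0" using pq A' VB AB unfolding A_def V_def by auto
      then have yq: "0 < y q" using ybd[of q] by linarith
      then have "0 < w q" using ybd[of q] q by linarith
      then have "0 < w p" using weight_pos_below pq q by blast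
      moreover have "y p = w p" using ynest pq q False yq by blast
      ultimately show ?thesis unfolding V_def by simp
    qed
    show "\<not> star p \<preceq> q" if "p \<in> V \<union> A'" "q \<in> V \<union> A'" for p q
    proof
      assume "star p \<preceq> q"
      moreover have "p \<in> B" "q \<in> B" "y p \<noteq> 0" "y q \<noteq> 0"
        using that A' VB AB unfolding A_def V_def by auto
      ultimately show False using yex by blast
    qed
  qed
  have Uu: "ultrafilter U" using uf[of "{}"] unfolding U_def by simp
  have AU: "A \<subseteq> U" using AB unfolding U_def flip_def A_def V_def by auto
  have "spans_cube U A"
    unfolding spans_cube_def
  proof (intro conjI ballI allI impI)
    fix p assume "p \<in> A"
    moreover from this have "0 < w p"
      using AB ybd[of p] unfolding A_def by auto
    ultimately show "proper p" using AB proper_iff_weight_pos by blast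
  next
    fix A' assume A': "A' \<subseteq> A"
    have "flip U A' = flip B (V \<union> A')"
    proof -
      have "star ` V \<inter> A' = {}" using VB AB A' star_notin_B by blast
      then show ?thesis unfolding U_def flip_def by blast
    qed
    then show "ultrafilter (flip U A')" using uf[OF A'] by simp
  qed (use Uu AU finA in auto)
  moreover have "U \<in> component B"
  proof -
    have "U - B \<subseteq> star ` V" unfolding U_def flip_def by blast
    then have "finite (U - B)" using finV by (meson finite_imageI finite_subset)
    then show ?thesis using Uu component_eq[OF base] by blast
  qed
  moreover have point: "z \<in> face w B U A"
    if z: "cubing_point z" "\<And>p. y p = 0 \<Longrightarrow> z p = 0" "\<And>p. p \<in> B \<Longrightarrow> y p = w p \<Longrightarrow> z p = w p" for z
  proof -
    have wA: "p \<in> A \<Longrightarrow> 0 < w p" for p using AB ybd[of p] unfolding A_def by force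
    have zbd: "p \<in> B \<Longrightarrow> 0 \<le> z p \<and> z p \<le> w p" and zoff: "p \<notin> B \<Longrightarrow> z p = 0" for p
      using cubing_pointD(2-4)[OF z(1)] by blast+
    let ?t = "\<lambda>p. z p / w p"
    have "?t \<in> A \<rightarrow> {0..1}" using wA zbd AB by (auto simp: Pi_iff divide_simps)
    moreover have "z = affine_extension w B U A ?t"
    proof
      fix p
      show "z p = affine_extension w B U A ?t p"
      proof (cases "p \<in> B")
        case False
        then show ?thesis using zoff affine_extension_off_base by simp
      next
        case True
        have "star p \<notin> A" "star p \<notin> V" using True star_notin_B AB VB by blast+
        then show ?thesis
          using affine_extension_coords[OF \<open>spans_cube U A\<close> True, of ?t] wA[of p]
            mem_flip_base[OF VB B_in_P[OF True]] True z(2,3)[of p] ybd[OF True]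
          unfolding U_def by (auto simp: A_def V_def)
      qed
    qed
    ultimately show ?thesis unfolding face_def by blast
  qed
  ultimately show ?thesis
    using point[OF x zero full] point[OF y] unfolding faces_def by blast
qed

lemma mem_cubing_iff: "x \<in> cubing w B \<longleftrightarrow> cubing_point x"
  using common_face[of x x] face_subset_cubing_point unfolding cubing_def by blast

text \<open>
  Midpoints witness that faces are compatible with the conditions on pairs of coordinates: two
  coordinates that are positive at one of two points of a face each are both positive at the midpoint.
\<close>

lemma midpoint_in_face:
  assumes F: "F \<in> faces w B" and x: "x \<in> F" and y: "y \<in> F"
  shows "(\<lambda>p. (x p + y p) / 2) \<in> F"
proof -
  obtain U A where F: "F = face w B U A" using F unfolding faces_def by blast
  obtain s t where s: "s \<in> A \<rightarrow> {0..1}" "x = affine_extension w B U A s"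
    and t: "t \<in> A \<rightarrow> {0..1}" "y = affine_extension w B U A t"
    using x y unfolding F face_def by blast
  let ?r = "\<lambda>a. (s a + t a) / 2"
  have "(s a + t a) / 2 \<in> {0..1}" if "a \<in> A" for a
    using funcset_mem[OF s(1) that] funcset_mem[OF t(1) that] by auto
  then have "?r \<in> A \<rightarrow> {0..1}" by blast
  moreover have "(\<lambda>p. (x p + y p) / 2) = affine_extension w B U A ?r"
  proof
    fix p
    let ?D = "\<lambda>a. vertex_point w B (flip U {a}) p - vertex_point w B U p"
    have "(\<Sum>a\<in>A. ?r a * ?D a) = ((\<Sum>a\<in>A. s a * ?D a) + (\<Sum>a\<in>A. t a * ?D a)) / 2"
      unfolding sum.distrib[symmetric] sum_divide_distrib by (intro sum.cong) (auto simp: distrib_right)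
    then show "(x p + y p) / 2 = affine_extension w B U A ?r p"
      unfolding s(2) t(2) affine_extension_def by simp
  qed
  ultimately show ?thesis unfolding F face_def by blast
qed

lemma abs_le_linf_dist:
  assumes x: "cubing_point x" and y: "cubing_point y"
  shows "\<bar>x p - y p\<bar> \<le> linf_dist B x y"
proof -
  have "(\<lambda>p. \<bar>x p - y p\<bar>) ` B \<subseteq> insert 0 ((\<lambda>p. \<bar>x p - y p\<bar>) ` ({p. x p \<noteq> 0} \<union> {p. y p \<noteq> 0}))"
    by auto
  moreover have "finite ({p. x p \<noteq> 0} \<union> {p. y p \<noteq> 0})"
    using x y unfolding cubing_point_def by simp
  ultimately have bdd: "bdd_above ((\<lambda>p. \<bar>x p - y p\<bar>) ` B)"
    by (meson bdd_above_mono bdd_above_finite finite_imageI finite_insert)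
  have le: "p \<in> B \<Longrightarrow> \<bar>x p - y p\<bar> \<le> linf_dist B x y" for p
    unfolding linf_dist_def by (rule cSUP_upper[OF _ bdd])
  show ?thesis
  proof (cases "p \<in> B")
    case False
    then have "\<bar>x p - y p\<bar> = 0" using x y unfolding cubing_point_def by simp
    also have "0 \<le> linf_dist B x y"
      using le[OF star_zero_in_ultrafilter[OF base]] abs_ge_zero order_trans by blast
    finally show ?thesis .
  qed (rule le)
qed

lemma linf_dist_le: "(\<And>p. p \<in> B \<Longrightarrow> \<bar>x p - y p\<bar> \<le> e) \<Longrightarrow> linf_dist B x y \<le> e"
  unfolding linf_dist_def using star_zero_in_ultrafilter[OF base] by (intro cSUP_least) auto

lemma linf_dist_commute: "linf_dist B x y = linf_dist B y x"
  unfolding linf_dist_def by (simp add: abs_minus_commute)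

section \<open>Composing chains\<close>

lemma chain_lengthsE:
  assumes "L \<in> chain_lengths w B x y"
  obtains c and m :: nat where "L = (\<Sum>i=1..m. linf_dist B (c i) (c (i - 1)))" "c 0 = x" "c m = y"
    "\<forall>i\<in>{1..m}. \<exists>F\<in>faces w B. c (i - 1) \<in> F \<and> c i \<in> F"
proof -
  have "\<exists>(m::nat) c. L = (\<Sum>i=1..m. linf_dist B (c i) (c (i - 1))) \<and> c 0 = x \<and> c m = y \<and>
      (\<forall>i\<in>{1..m}. \<exists>F\<in>faces w B. c (i - 1) \<in> F \<and> c i \<in> F)"
    using assms unfolding chain_lengths_def by (simp only: mem_Collect_eq)
  then show ?thesis using that by blast
qed

lemma chain_lengths_refl: "0 \<in> chain_lengths w B x x"
  unfolding chain_lengths_def by (intro CollectI exI[of _ 0] exI[of _ "\<lambda>_. x"]) simp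

lemma chain_lengths_step:
  assumes "F \<in> faces w B" "x \<in> F" "y \<in> F"
  shows "linf_dist B x y \<in> chain_lengths w B x y"
  unfolding chain_lengths_def using assms
  by (intro CollectI exI[of _ 1] exI[of _ "\<lambda>i. if i = 0 then x else y"])
     (auto simp: linf_dist_commute)

lemma chain_lengths_append:
  assumes "K \<in> chain_lengths w B x y" "L \<in> chain_lengths w B y z"
  shows "K + L \<in> chain_lengths w B x z"
proof -
  obtain c and m :: nat where c: "K = (\<Sum>i=1..m. linf_dist B (c i) (c (i - 1)))" "c 0 = x" "c m = y"
    "\<forall>i\<in>{1..m}. \<exists>F\<in>faces w B. c (i - 1) \<in> F \<and> c i \<in> F"
    by (rule chain_lengthsE[OF assms(1)])
  obtain e and n :: nat where e: "L = (\<Sum>i=1..n. linf_dist B (e i) (e (i - 1)))" "e 0 = y" "e n = z"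
    "\<forall>i\<in>{1..n}. \<exists>F\<in>faces w B. e (i - 1) \<in> F \<and> e i \<in> F"
    by (rule chain_lengthsE[OF assms(2)])
  define h where "h i = (if i \<le> m then c i else e (i - m))" for i
  have h1: "h i = c i" if "i \<le> m" for i using that by (simp add: h_def)
  have h2: "h (i + m) = e i" for i using c(3) e(2) by (simp add: h_def)
  have h3: "h (i + m - Suc 0) = e (i - Suc 0)" if "Suc 0 \<le> i" for i
    using h2[of "i - 1"] that by simp
  have "(\<Sum>i=1..m+n. linf_dist B (h i) (h (i - 1))) =
      (\<Sum>i=1..m. linf_dist B (h i) (h (i - 1))) + (\<Sum>i=m+1..m+n. linf_dist B (h i) (h (i - 1)))"
    by (subst sum.ub_add_nat) auto
  also have "(\<Sum>i=1..m. linf_dist B (h i) (h (i - 1))) = K"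
    unfolding c(1) by (intro sum.cong) (auto simp: h1)
  also have "(\<Sum>i=m+1..m+n. linf_dist B (h i) (h (i - 1))) = (\<Sum>i=1..n. linf_dist B (h (i + m)) (h (i + m - 1)))"
    using sum.shift_bounds_cl_nat_ivl[of "\<lambda>i. linf_dist B (h i) (h (i - 1))" 1 m n]
    by (simp add: add.commute)
  also have "\<dots> = L"
    unfolding e(1) by (intro sum.cong) (auto simp: h2 h3)
  finally have "K + L = (\<Sum>i=1..m+n. linf_dist B (h i) (h (i - 1)))" by simp
  moreover have "\<exists>F\<in>faces w B. h (i - 1) \<in> F \<and> h i \<in> F" if "i \<in> {1..m+n}" for i
  proof (cases "i \<le> m")
    case True
    then show ?thesis using c(4)[rule_format, of i] that h1 by simp
  next
    case False
    then have "i = (i - m) + m" "i - m \<in> {1..n}" using that by auto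
    then obtain j where "i = j + m" "j \<in> {1..n}" by blast
    then show ?thesis using e(4)[rule_format, of j] h2[of j] h3[of j] by simp
  qed
  moreover have "h 0 = x" "h (m + n) = z" using c e h1 h2[of n] by (auto simp: add.commute)
  ultimately show ?thesis unfolding chain_lengths_def by blast
qed

lemma chain_lengths_commute:
  assumes "L \<in> chain_lengths w B x y"
  shows "L \<in> chain_lengths w B y x"
proof -
  obtain c and m :: nat where c: "L = (\<Sum>i=1..m. linf_dist B (c i) (c (i - 1)))" "c 0 = x" "c m = y"
    "\<forall>i\<in>{1..m}. \<exists>F\<in>faces w B. c (i - 1) \<in> F \<and> c i \<in> F"
    by (rule chain_lengthsE[OF assms])
  have fwd: "(\<Sum>i=1..k. linf_dist B (c i) (c (i - 1))) \<in> chain_lengths w B (c k) (c 0)" if "k \<le> m" for k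
    using that
  proof (induction k)
    case 0
    then show ?case using chain_lengths_refl by simp
  next
    case (Suc k)
    obtain F where "F \<in> faces w B" "c k \<in> F" "c (Suc k) \<in> F" using c(4)[rule_format, of "Suc k"] Suc by auto
    then have "linf_dist B (c (Suc k)) (c k) \<in> chain_lengths w B (c (Suc k)) (c k)"
      using chain_lengths_step by blast
    then show ?case using chain_lengths_append Suc by (fastforce simp: add.commute)
  qed
  show ?thesis using fwd[of m] c by simp
qed

lemma chain_lengths_induct [consumes 1, case_names refl step]:
  assumes "L \<in> chain_lengths w B x y"
    and "R 0 x"
    and "\<And>K y z F. R K y \<Longrightarrow> F \<in> faces w B \<Longrightarrow> y \<in> F \<Longrightarrow> z \<in> F \<Longrightarrow> R (K + linf_dist B y z) z"
  shows "R L y"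
proof -
  obtain c and m :: nat where c: "L = (\<Sum>i=1..m. linf_dist B (c i) (c (i - 1)))" "c 0 = x" "c m = y"
    "\<forall>i\<in>{1..m}. \<exists>F\<in>faces w B. c (i - 1) \<in> F \<and> c i \<in> F"
    by (rule chain_lengthsE[OF assms(1)])
  have "R (\<Sum>i=1..k. linf_dist B (c i) (c (i - 1))) (c k)" if "k \<le> m" for k
    using that
  proof (induction k)
    case 0
    then show ?case using c assms(2) by simp
  next
    case (Suc k)
    obtain F where "F \<in> faces w B" "c k \<in> F" "c (Suc k) \<in> F" using c(4)[rule_format, of "Suc k"] Suc by auto
    then show ?case
      using assms(3)[OF Suc.IH, of F "c (Suc k)"] Suc linf_dist_commute[of "c k" "c (Suc k)"] by simp
  qed
  then show ?thesis using c by blast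
qed

end

section \<open>Profiles, clipping and short chains\<close>

context finite_piecewise_linf_cubing
begin

text \<open>
  \<open>B\<close> can be infinite even if the cubing is finite. Only the walls that some point of the cubing has
  entered matter, and there are finitely many of them.
\<close>

definition movable :: "'a set" where
  "movable = {p. \<exists>x. cubing_point x \<and> x p \<noteq> 0}"

lemma movable_subset: "movable \<subseteq> B"
  using cubing_point_off unfolding movable_def by blast

lemma not_movable: "cubing_point x \<Longrightarrow> p \<notin> movable \<Longrightarrow> x p = 0"
  unfolding movable_def by blast

lemma finite_component: "finite (component B)"
proof (rule finite_imageD)
  have "(\<lambda>U. {U}) ` component B \<subseteq> cubes B"
  proof (rule image_subsetI)
    fix U assume U: "U \<in> component B"
    then have "spans_cube U {}" using component_eq[OF base] unfolding spans_cube_def by simp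
    then show "{U} \<in> cubes B"
      using U unfolding cubes_def
      by (intro CollectI exI[of _ U] exI[of _ "{}"]) (simp add: cube_vertices_def)
  qed
  then show "finite ((\<lambda>U. {U}) ` component B)" using finite_cubes by (rule finite_subset)
qed (simp add: inj_on_def)

text \<open>
  The walls entered by a point are the walls crossed by some vertex of the component. There are
  finitely many such vertices, and each of them crosses finitely many walls.
\<close>

lemma finite_movable: "finite movable"
proof -
  have "movable \<subseteq> (\<Union>U\<in>component B. B - U)"
  proof
    fix p assume "p \<in> movable"
    then obtain x where x: "cubing_point x" "x p \<noteq> 0" unfolding movable_def by blast
    define T where "T = {p. x p \<noteq> 0}"
    have TB: "T \<subseteq> B" using cubing_point_off[OF x(1)] unfolding T_def by blast
    have "ultrafilter (flip B T)"
    proof (rule ultrafilter_flip_base[OF TB])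
      fix p q assume pq: "p \<in> B" "q \<in> T" "p \<preceq> q"
      show "p \<in> T"
      proof (cases "p = q")
        case False
        have q: "0 < x q" "q \<in> B"
          using pq(2) TB cubing_point_nonneg[OF x(1), of q] unfolding T_def by auto
        have "0 < w q" using cubing_point_le[OF x(1) q(2)] q(1) by simp
        then have "0 < w p" using weight_pos_below[OF pq(1) q(2) pq(3)] by blast
        then show ?thesis
          using cubing_point_nested[OF x(1) pq(1) q(2) pq(3) False q(1)] unfolding T_def by simp
      qed (use pq in simp)
    next
      fix p q assume "p \<in> T" "q \<in> T"
      then show "\<not> star p \<preceq> q"
        using cubing_point_exclusive[OF x(1), of p q] TB unfolding T_def by auto
    qed
    moreover have "finite (flip B T - B)"
      using cubing_point_finite[OF x(1)] unfolding flip_def T_def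
      by (rule finite_subset[rotated, OF finite_imageI]) blast
    ultimately have "flip B T \<in> component B" using component_eq[OF base] by blast
    moreover have "p \<in> T" "p \<in> B" using x(2) TB unfolding T_def by auto
    then have "p \<in> B - flip B T" using mem_flip_base[OF TB B_in_P] star_notin_B TB by blast
    ultimately show "p \<in> (\<Union>U\<in>component B. B - U)" by blast
  qed
  then show ?thesis
    using finite_component finite_base_diff by (meson finite_UN finite_subset)
qed

text \<open>
  The values of a profile model depths lowered by a common amount. So they may be negative, and the
  condition on nested walls is asked only where the value at the farther wall is positive.
\<close>

definition profile :: "('a \<Rightarrow> real) \<Rightarrow> bool" where
  "profile u \<longleftrightarrow>
     (\<forall>p\<in>B. p \<notin> movable \<longrightarrow> u p \<le> 0) \<and>
     (\<forall>p\<in>B. \<forall>q\<in>B. p \<preceq> q \<longrightarrow> p \<noteq> q \<longrightarrow> 0 < u q \<longrightarrow> w p + u q \<le> u p)"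

text \<open>
  The bounds that a chain of length \<open>e\<close> imposes on the depths of its end points. With \<open>u = v\<close> and
  \<open>e = 0\<close> the second condition says that \<open>u\<close> is not positive at two walls with disjoint far sides.
\<close>

definition profiles_within :: "real \<Rightarrow> ('a \<Rightarrow> real) \<Rightarrow> ('a \<Rightarrow> real) \<Rightarrow> bool" where
  "profiles_within e u v \<longleftrightarrow>
     (\<forall>p\<in>B. \<bar>u p - v p\<bar> \<le> e) \<and>
     (\<forall>p\<in>B. \<forall>q\<in>B. star p \<preceq> q \<longrightarrow> 0 < u p \<longrightarrow> 0 < v q \<longrightarrow> u p + v q \<le> e)"

definition clip :: "('a \<Rightarrow> real) \<Rightarrow> 'a \<Rightarrow> real" where
  "clip u p = (if p \<in> B then min (w p) (max 0 (u p)) else 0)"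

lemma profile_off: "profile u \<Longrightarrow> p \<in> B \<Longrightarrow> p \<notin> movable \<Longrightarrow> u p \<le> 0"
  and profile_nested: "profile u \<Longrightarrow> p \<in> B \<Longrightarrow> q \<in> B \<Longrightarrow> p \<preceq> q \<Longrightarrow> p \<noteq> q \<Longrightarrow> 0 < u q \<Longrightarrow> w p + u q \<le> u p"
  unfolding profile_def by blast+

lemma profiles_within_abs: "profiles_within e u v \<Longrightarrow> p \<in> B \<Longrightarrow> \<bar>u p - v p\<bar> \<le> e"
  and profiles_within_opposite: "profiles_within e u v \<Longrightarrow> p \<in> B \<Longrightarrow> q \<in> B \<Longrightarrow> star p \<preceq> q \<Longrightarrow> 0 < u p \<Longrightarrow> 0 < v q \<Longrightarrow> u p + v q \<le> e"
  unfolding profiles_within_def by blast+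

lemma profiles_within_commute: "profiles_within e u v \<Longrightarrow> profiles_within e v u"
  unfolding profiles_within_def using star_le_commute by (auto simp: abs_minus_commute add.commute)

text \<open>
  For walls with disjoint far sides, a positive value of \<open>v\<close> at one of them lets the second condition be
  used with \<open>v\<close> in place of \<open>u\<close> or \<open>z\<close>. If \<open>v\<close> is nonpositive at both, the first condition bounds \<open>u\<close>
  and \<open>z\<close> separately.
\<close>

lemma profiles_within_triangle:
  assumes "profiles_within d u v" "profiles_within e v z"
  shows "profiles_within (d + e) u z"
  unfolding profiles_within_def
proof (intro conjI ballI impI)
  fix p assume "p \<in> B"
  then show "\<bar>u p - z p\<bar> \<le> d + e"
    using profiles_within_abs[OF assms(1)] profiles_within_abs[OF assms(2)] by fastforce
next
  fix p q assume pq: "p \<in> B" "q \<in> B" "star p \<preceq> q" "0 < u p" "0 < z q"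
  have a: "u p \<le> v p + d" "z q \<le> v q + e"
    using profiles_within_abs[OF assms(1) pq(1)] profiles_within_abs[OF assms(2) pq(2)] by linarith+
  consider "0 < v p" | "0 < v q" | "v p \<le> 0" "v q \<le> 0" by linarith
  then show "u p + z q \<le> d + e"
  proof cases
    case 1
    then show ?thesis using profiles_within_opposite[OF assms(2) pq(1-3) 1 pq(5)] a by linarith
  next
    case 2
    then show ?thesis using profiles_within_opposite[OF assms(1) pq(1-4) 2] a by linarith
  qed (use a in linarith)
qed

lemma cubing_point_clip:
  assumes u: "profile u" and uu: "profiles_within 0 u u"
  shows "cubing_point (clip u)"
  unfolding cubing_point_def
proof (intro conjI allI ballI impI)
  have "clip u p = 0" if "p \<notin> movable" for p
    using profile_off[OF u _ that] weight_nonneg[of p] unfolding clip_def by auto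
  then have "{p. clip u p \<noteq> 0} \<subseteq> movable" by blast
  then show "finite {p. clip u p \<noteq> 0}" using finite_movable by (rule finite_subset)
next
  fix p q assume pq: "p \<in> B" "q \<in> B" "p \<preceq> q" "p \<noteq> q" "0 < clip u q"
  then have "0 < u q" unfolding clip_def by (auto simp: min_def max_def split: if_splits)
  then have "w p \<le> u p" using profile_nested[OF u pq(1-4)] by linarith
  then show "clip u p = w p" using pq weight_nonneg[of p] unfolding clip_def by auto
next
  fix p q assume pq: "p \<in> B" "q \<in> B" "star p \<preceq> q"
  then have "u p \<le> 0 \<or> u q \<le> 0" using profiles_within_opposite[OF uu pq] by linarith
  then show "clip u p = 0 \<or> clip u q = 0" using pq weight_nonneg unfolding clip_def by auto
qed (use weight_nonneg in \<open>auto simp: clip_def\<close>)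

text \<open>
  If \<open>y\<close> is close enough to \<open>x\<close>, its coordinates can be \<open>0\<close> or full only where those of \<open>x\<close> are, so the
  face with \<open>y\<close> in its relative interior contains \<open>x\<close>. The radius \<open>e\<close> is \<open>1\<close> or, if
  smaller, the least distance of a coordinate of \<open>x\<close> at a movable wall from an end of its range that it
  does not attain.
\<close>

lemma locally_common_face:
  assumes x: "cubing_point x"
  shows "\<exists>e>0. \<forall>y. cubing_point y \<longrightarrow> (\<forall>p. \<bar>x p - y p\<bar> < e) \<longrightarrow> (\<exists>F\<in>faces w B. x \<in> F \<and> y \<in> F)"
proof -
  define E where "E = insert 1 (x ` {p\<in>movable. x p \<noteq> 0} \<union> (\<lambda>p. w p - x p) ` {p\<in>movable. x p < w p})"
  have fin: "finite E" using finite_movable unfolding E_def by simp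
  define e where "e = Min E"
  have "\<forall>d\<in>E. 0 < d" using cubing_point_nonneg[OF x] unfolding E_def by (auto simp: less_le)
  then have pos: "0 < e" using fin unfolding e_def by (subst Min_gr_iff) (auto simp: E_def)
  have le: "d \<in> E \<Longrightarrow> e \<le> d" for d unfolding e_def using fin by simp
  have "\<exists>F\<in>faces w B. x \<in> F \<and> y \<in> F" if y: "cubing_point y" and xy: "\<And>p. \<bar>x p - y p\<bar> < e" for y
  proof (rule common_face[OF x y])
    fix p assume y0: "y p = 0"
    show "x p = 0"
    proof (rule ccontr)
      assume n: "x p \<noteq> 0"
      then have "x p \<in> E" using not_movable[OF x] unfolding E_def by blast
      then show False using le[of "x p"] xy[of p] y0 by simp
    qed
  next
    fix p assume p: "p \<in> B" "y p = w p"
    show "x p = w p"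
    proof (rule ccontr)
      assume n: "x p \<noteq> w p"
      then have "x p < w p" using cubing_point_le[OF x p(1)] by simp
      moreover have "p \<in> movable" using n p(2) not_movable[OF x] not_movable[OF y] by metis
      ultimately have "w p - x p \<in> E" unfolding E_def by blast
      then show False using le[of "w p - x p"] xy[of p] p(2) by simp
    qed
  qed
  then show ?thesis using pos by blast
qed

lemma abs_clip_diff_le: "\<bar>clip u p - clip v p\<bar> \<le> \<bar>u p - v p\<bar>"
  unfolding clip_def by auto

lemma profiles_within_nonneg: "profiles_within e u v \<Longrightarrow> 0 \<le> e"
  using profiles_within_abs[OF _ star_zero_in_ultrafilter[OF base]] abs_ge_zero order_trans by blast

text \<open>
  Along the path of profiles \<open>max (u - t) (v - (e - t))\<close> a value decreases as long as it is dominated by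
  \<open>u\<close> and then increases towards \<open>v\<close>. The second condition in \<open>profiles_within e u v\<close> ensures that, for
  walls with disjoint far sides, the value at one has become nonpositive before the value at the other
  becomes positive, so the clipped path stays in the cubing. Each of its points shares a face
  with every nearby point of it, and a bisection argument glues the local estimates.
\<close>

lemma short_chain_between_clips:
  assumes u: "profile u" and v: "profile v"
    and uu: "profiles_within 0 u u" and vv: "profiles_within 0 v v" and uv: "profiles_within e u v"
  shows "\<exists>L\<in>chain_lengths w B (clip u) (clip v). L \<le> e"
proof -
  define m where "m t p = max (u p - t) (v p - (e - t))" for t p
  define \<gamma> where "\<gamma> t = clip (m t)" for t
  have e0: "0 \<le> e" using profiles_within_nonneg[OF uv] .
  have point: "cubing_point (\<gamma> t)" if t: "0 \<le> t" "t \<le> e" for t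
    unfolding \<gamma>_def
  proof (rule cubing_point_clip)
    show "profile (m t)"
      unfolding profile_def
    proof (intro conjI ballI impI)
      fix p assume "p \<in> B" "p \<notin> movable"
      then show "m t p \<le> 0" using profile_off[OF u] profile_off[OF v] t unfolding m_def by fastforce
    next
      fix p q assume pq: "p \<in> B" "q \<in> B" "p \<preceq> q" "p \<noteq> q" "0 < m t q"
      consider "m t q = u q - t" "0 < u q" | "m t q = v q - (e - t)" "0 < v q"
        using pq(5) t unfolding m_def by linarith
      then show "w p + m t q \<le> m t p"
        using profile_nested[OF u pq(1-4)] profile_nested[OF v pq(1-4)]
        by cases (auto simp: m_def)
    qed
    show "profiles_within 0 (m t) (m t)"
      unfolding profiles_within_def
    proof (intro conjI ballI impI)
      fix p q assume pq: "p \<in> B" "q \<in> B" "star p \<preceq> q" "0 < m t p" "0 < m t q"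
      have "u p > t \<or> v p > e - t" "u q > t \<or> v q > e - t"
        using pq(4,5) unfolding m_def by linarith+
      then have False
        using profiles_within_opposite[OF uu pq(1-3)] profiles_within_opposite[OF vv pq(1-3)]
          profiles_within_opposite[OF uv pq(1-3)]
          profiles_within_opposite[OF profiles_within_commute[OF uv] pq(1-3)] t by linarith
      then show "m t p + m t q \<le> 0" ..
    qed simp
  qed
  have lip: "\<bar>\<gamma> s p - \<gamma> t p\<bar> \<le> \<bar>s - t\<bar>" for s t p
    unfolding \<gamma>_def by (rule order_trans[OF abs_clip_diff_le]) (simp add: m_def max_def abs_if)
  have step: "\<exists>L\<in>chain_lengths w B (\<gamma> s) (\<gamma> t). L \<le> t - s"
    if "F \<in> faces w B" "\<gamma> s \<in> F" "\<gamma> t \<in> F" "s \<le> t" for s t F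
  proof
    show "linf_dist B (\<gamma> s) (\<gamma> t) \<in> chain_lengths w B (\<gamma> s) (\<gamma> t)"
      using chain_lengths_step that by blast
    show "linf_dist B (\<gamma> s) (\<gamma> t) \<le> t - s"
      by (rule linf_dist_le, rule order_trans[OF lip]) (use that in simp)
  qed
  have join: "\<exists>L\<in>chain_lengths w B x z. L \<le> c - a"
    if xyz: "\<exists>L\<in>chain_lengths w B x y. L \<le> b - a" "\<exists>L\<in>chain_lengths w B y z. L \<le> c - b"
    for x y z and a b c :: real
  proof -
    obtain K where K: "K \<in> chain_lengths w B x y" "K \<le> b - a" using xyz(1) ..
    obtain L where L: "L \<in> chain_lengths w B y z" "L \<le> c - b" using xyz(2) ..
    show ?thesis
      using chain_lengths_append[OF K(1) L(1)] K(2) L(2) by (intro bexI[of _ "K + L"]) simp_all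
  qed
  define R where "R a b \<longleftrightarrow> (0 \<le> a \<longrightarrow> b \<le> e \<longrightarrow> (\<exists>L\<in>chain_lengths w B (\<gamma> a) (\<gamma> b). L \<le> b - a))" for a b
  have "R 0 e"
    using e0
  proof (induction rule: Bolzano)
    case (trans a b c)
    then show ?case using join[of "\<gamma> a" "\<gamma> b" b a "\<gamma> c" c] unfolding R_def by simp
  next
    case (local x)
    obtain d where d: "0 < d" "\<And>y. cubing_point y \<Longrightarrow> (\<And>p. \<bar>\<gamma> x p - y p\<bar> < d)
        \<Longrightarrow> \<exists>F\<in>faces w B. \<gamma> x \<in> F \<and> y \<in> F"
      using locally_common_face[OF point[OF local]] by blast
    have seg: "\<exists>L\<in>chain_lengths w B (\<gamma> a) (\<gamma> b). L \<le> b - a"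
      if ab: "0 \<le> a" "b \<le> e" "a \<le> x" "x \<le> b" "b - a < d" for a b
    proof (rule join)
      have near: "\<bar>\<gamma> x p - \<gamma> a p\<bar> < d" "\<bar>\<gamma> x p - \<gamma> b p\<bar> < d" for p
        using lip[of x p a] lip[of x p b] ab by linarith+
      obtain F where F: "F \<in> faces w B" "\<gamma> x \<in> F" "\<gamma> a \<in> F"
        using d(2)[OF point near(1)] ab local by auto
      obtain F' where F': "F' \<in> faces w B" "\<gamma> x \<in> F'" "\<gamma> b \<in> F'"
        using d(2)[OF point near(2)] ab local by auto
      show "\<exists>L\<in>chain_lengths w B (\<gamma> a) (\<gamma> x). L \<le> x - a"
        using step[OF F(1,3,2) ab(3)] .
      show "\<exists>L\<in>chain_lengths w B (\<gamma> x) (\<gamma> b). L \<le> b - x"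
        using step[OF F' ab(4)] .
    qed
    show ?case
      unfolding R_def
    proof (intro exI[of _ d] conjI allI impI d(1))
      fix a b
      assume "a \<le> x \<and> x \<le> b \<and> b - a < d" "0 \<le> a" "b \<le> e"
      then show "\<exists>L\<in>chain_lengths w B (\<gamma> a) (\<gamma> b). L \<le> b - a" by (intro seg) simp_all
    qed
  qed
  moreover have "m 0 p = u p" "m e p = v p" if "p \<in> B" for p
    using profiles_within_abs[OF uv that] unfolding m_def by linarith+
  then have "\<gamma> 0 = clip u" "\<gamma> e = clip v"
    unfolding \<gamma>_def by (simp_all add: fun_eq_iff clip_def)
  ultimately show ?thesis using e0 unfolding R_def by simp
qed

section \<open>The depth of a point behind a wall\<close>

text \<open>
  Chains are taken in \<open>movable\<close>, which makes the maximum in the definition of depth one over a finite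
  set. The empty chain is included, so depths are nonnegative at every wall.
\<close>

definition chains_above :: "'a \<Rightarrow> 'a set set" where
  "chains_above p = {C. C \<subseteq> {q\<in>movable. p \<preceq> q} \<and> (\<forall>a\<in>C. \<forall>b\<in>C. a \<preceq> b \<or> b \<preceq> a)}"

definition depth :: "('a \<Rightarrow> real) \<Rightarrow> 'a \<Rightarrow> real" where
  "depth x p = Max (sum x ` chains_above p)"

lemma finite_chains_above: "finite (chains_above p)"
  by (rule finite_subset[of _ "Pow movable"]) (auto simp: chains_above_def finite_movable)

lemma chains_aboveD:
  assumes "C \<in> chains_above p"
  shows "finite C" "c \<in> C \<Longrightarrow> c \<in> movable" "c \<in> C \<Longrightarrow> c \<in> B" "c \<in> C \<Longrightarrow> p \<preceq> c"
    "c \<in> C \<Longrightarrow> d \<in> C \<Longrightarrow> c \<preceq> d \<or> d \<preceq> c"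
proof -
  show "finite C"
    by (rule finite_subset[OF _ finite_movable]) (use assms chains_above_def in auto)
qed (use assms movable_subset in \<open>auto simp: chains_above_def\<close>)

lemma sum_le_depth: "C \<in> chains_above p \<Longrightarrow> sum x C \<le> depth x p"
  unfolding depth_def using finite_chains_above by (intro Max_ge) auto

lemma depth_attained:
  obtains C where "C \<in> chains_above p" "depth x p = sum x C"
proof -
  have "{} \<in> chains_above p" by (simp add: chains_above_def)
  then have "Max (sum x ` chains_above p) \<in> sum x ` chains_above p"
    using finite_chains_above by (intro Max_in) auto
  then show ?thesis using that unfolding depth_def by blast
qed

lemma depth_nonneg: "0 \<le> depth x p"
  using sum_le_depth[of "{}" p x] by (simp add: chains_above_def)

lemma depth_le_total_weight:
  assumes "cubing_point x"
  shows "depth x p \<le> sum w movable"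
proof -
  obtain C where C: "C \<in> chains_above p" "depth x p = sum x C" by (rule depth_attained)
  have "sum x C \<le> sum x movable"
    using chains_aboveD(2)[OF C(1)] finite_movable cubing_point_nonneg[OF assms] by (intro sum_mono2) auto
  also have "\<dots> \<le> sum w movable"
    using cubing_point_le[OF assms] movable_subset by (intro sum_mono) auto
  finally show ?thesis using C(2) by simp
qed

lemma le_depth:
  assumes x: "cubing_point x" and p: "p \<in> B"
  shows "x p \<le> depth x p"
proof (cases "p \<in> movable")
  case True
  have "p \<preceq> p" using le_refl B_in_P[OF p] by (auto simp: reflp_on_def)
  then have "{p} \<in> chains_above p" using True unfolding chains_above_def by simp
  from sum_le_depth[OF this, of x] show ?thesis by simp
next
  case False
  then show ?thesis using not_movable[OF x] depth_nonneg by simp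
qed

lemma pos_if_pos_above:
  assumes x: "cubing_point x" and pq: "p \<in> B" "q \<in> B" "p \<preceq> q" "0 < x q"
  shows "0 < x p"
proof (cases "p = q")
  case False
  have "0 < w q" using cubing_point_le[OF x pq(2)] pq(4) by linarith
  then show ?thesis
    using cubing_point_nested[OF x pq(1-3) False pq(4)] weight_pos_below[OF pq(1-3)] by simp
qed (use pq in simp)

text \<open>
  A positive coordinate at a wall behind \<open>p\<close> forces \<open>p\<close> to be crossed.
\<close>

lemma depth_pos_imp_pos:
  assumes x: "cubing_point x" and p: "p \<in> B" and pos: "0 < depth x p"
  shows "0 < x p"
proof -
  obtain C where C: "C \<in> chains_above p" "depth x p = sum x C" by (rule depth_attained)
  have "\<exists>q\<in>C. x q \<noteq> 0" using pos C(2) sum.neutral[of C x] by fastforce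
  then obtain q where q: "q \<in> C" "0 < x q" using cubing_point_nonneg[OF x] by (force simp: less_le)
  then show ?thesis using pos_if_pos_above[OF x p] chains_aboveD[OF C(1)] by blast
qed

text \<open>
  A chain behind \<open>q\<close> can be prolonged by a nearer wall \<open>p\<close>. If the depth behind \<open>q\<close> is positive, then
  \<open>p\<close> is fully crossed and contributes \<open>w p\<close>.
\<close>

lemma profile_depth:
  assumes x: "cubing_point x"
  shows "profile (depth x)"
  unfolding profile_def
proof (intro conjI ballI impI)
  fix p assume p: "p \<in> B" "p \<notin> movable"
  then show "depth x p \<le> 0" using depth_pos_imp_pos[OF x p(1)] not_movable[OF x p(2)] by force
next
  fix p q assume pq: "p \<in> B" "q \<in> B" "p \<preceq> q" "p \<noteq> q" "0 < depth x q"
  have xq: "0 < x q" using depth_pos_imp_pos[OF x pq(2,5)] .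
  have xp: "x p = w p" using cubing_point_nested[OF x pq(1-4) xq] .
  have "0 < x p" using pos_if_pos_above[OF x pq(1-3) xq] .
  then have pm: "p \<in> movable" using not_movable[OF x] by force
  obtain C where C: "C \<in> chains_above q" "depth x q = sum x C" by (rule depth_attained)
  note D = chains_aboveD[OF C(1)]
  have above: "p \<preceq> c" if "c \<in> C" for c
    using transp_onD[OF le_trans _ _ _ pq(3) D(4)[OF that]] pq(1,2) D(3)[OF that] B_in_P by blast
  have "p \<notin> C"
    using D(4)[of p] antisymp_onD[OF le_antisym _ _ pq(3)] pq(1,2,4) B_in_P by blast
  moreover have "insert p C \<in> chains_above p"
    using above pm D(2,5) le_refl B_in_P[OF pq(1)] unfolding chains_above_def by (auto simp: reflp_on_def)
  from sum_le_depth[OF this, of x] have "sum x (insert p C) \<le> depth x p" .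
  ultimately show "w p + depth x q \<le> depth x p" using D(1) C(2) xp by simp
qed

text \<open>
  The depth exceeds the coordinate only if some wall strictly behind \<open>p\<close> has been entered; then \<open>p\<close> has
  been crossed completely, and the cap at \<open>w p\<close> returns the coordinate.
\<close>

lemma clip_depth:
  assumes x: "cubing_point x"
  shows "clip (depth x) = x"
proof
  fix p
  show "clip (depth x) p = x p"
  proof (cases "p \<in> B \<and> depth x p \<noteq> x p")
    case True
    then have p: "p \<in> B" and lt: "x p < depth x p" using le_depth[OF x] by force+
    obtain C where C: "C \<in> chains_above p" "depth x p = sum x C" by (rule depth_attained)
    note D = chains_aboveD[OF C(1)]
    have "\<exists>c\<in>C. c \<noteq> p \<and> x c \<noteq> 0"
    proof (rule ccontr)
      assume "\<not> ?thesis"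
      then have "sum x C = sum x (C \<inter> {p})"
        using D(1) by (intro sum.mono_neutral_right) auto
      also have "\<dots> \<le> x p" using cubing_point_nonneg[OF x, of p] by (cases "p \<in> C") auto
      finally show False using lt C(2) by simp
    qed
    then obtain c where c: "c \<in> C" "c \<noteq> p" "0 < x c"
      using cubing_point_nonneg[OF x] by (force simp: less_le)
    then have "x p = w p" using cubing_point_nested[OF x p D(3,4)[OF c(1)]] by blast
    then show ?thesis using lt p cubing_point_nonneg[OF x, of p] unfolding clip_def by simp
  next
    case False
    then show ?thesis
      using cubing_point_le[OF x] cubing_point_nonneg[OF x, of p] cubing_point_off[OF x]
      unfolding clip_def by auto
  qed
qed

lemma profiles_within_depth_refl: "cubing_point x \<Longrightarrow> profiles_within 0 (depth x) (depth x)"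
  unfolding profiles_within_def using depth_pos_imp_pos cubing_point_exclusive by fastforce

text \<open>
  In an optimal chain for \<open>x\<close> at most one wall \<open>c\<close> has \<open>y c < x c\<close>: if there were a second one behind it,
  the midpoint of \<open>x\<close> and \<open>y\<close> would have entered the farther wall without having crossed the nearer one.
\<close>

lemma depth_diff_le_on_face:
  assumes F: "F \<in> faces w B" and xF: "x \<in> F" and yF: "y \<in> F"
  shows "depth x p - depth y p \<le> linf_dist B x y"
proof -
  have x: "cubing_point x" and y: "cubing_point y" using face_subset_cubing_point F xF yF by blast+
  have m: "cubing_point (\<lambda>p. (x p + y p) / 2)"
    using face_subset_cubing_point[OF F midpoint_in_face[OF F xF yF]] .
  obtain C where C: "C \<in> chains_above p" "depth x p = sum x C" by (rule depth_attained)
  note D = chains_aboveD[OF C(1)]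
  define S where "S = {c\<in>C. y c < x c}"
  have less: False if "c \<in> S" "d \<in> S" "c \<noteq> d" "c \<preceq> d" for c d
  proof -
    have cd: "c \<in> B" "d \<in> B" "y c < x c" "y d < x d" using that D(3) unfolding S_def by auto
    then have "0 < (x d + y d) / 2" using cubing_point_nonneg[OF y, of d] by simp
    then have "(x c + y c) / 2 = w c" using cubing_point_nested[OF m cd(1,2) that(4,3)] by simp
    then show False using cubing_point_le[OF x cd(1)] cd(3) by simp
  qed
  then have uniq: "c = d" if "c \<in> S" "d \<in> S" for c d
    using that D(5)[of c d] unfolding S_def by blast
  have "depth x p - depth y p \<le> sum x C - sum y C"
    using C(2) sum_le_depth[OF C(1), of y] by simp
  also have "\<dots> = (\<Sum>c\<in>C. x c - y c)" by (simp add: sum_subtractf)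
  also have "\<dots> \<le> (\<Sum>c\<in>S. x c - y c)"
  proof -
    have "(\<Sum>c\<in>C. x c - y c) = (\<Sum>c\<in>C - S. x c - y c) + (\<Sum>c\<in>S. x c - y c)"
      using D(1) by (intro sum.subset_diff) (auto simp: S_def)
    moreover have "(\<Sum>c\<in>C - S. x c - y c) \<le> 0"
      by (intro sum_nonpos) (auto simp: S_def)
    ultimately show ?thesis by simp
  qed
  also have "\<dots> \<le> linf_dist B x y"
  proof (cases "S = {}")
    case True
    then show ?thesis using order_trans[OF abs_ge_zero abs_le_linf_dist[OF x y]] by simp
  next
    case False
    then obtain c where "S = {c}" using uniq by blast
    then show ?thesis using abs_le_linf_dist[OF x y, of c] by simp
  qed
  finally show ?thesis .
qed

lemma profiles_within_on_face:
  assumes F: "F \<in> faces w B" and xF: "x \<in> F" and yF: "y \<in> F"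
  shows "profiles_within (linf_dist B x y) (depth x) (depth y)"
  unfolding profiles_within_def
proof (intro conjI ballI impI)
  fix p show "\<bar>depth x p - depth y p\<bar> \<le> linf_dist B x y"
    using depth_diff_le_on_face[OF F xF yF, of p] depth_diff_le_on_face[OF F yF xF, of p]
      linf_dist_commute[of x y] by simp
next
  fix p q assume pq: "p \<in> B" "q \<in> B" "star p \<preceq> q" "0 < depth x p" "0 < depth y q"
  have x: "cubing_point x" and y: "cubing_point y" using face_subset_cubing_point F xF yF by blast+
  have m: "cubing_point (\<lambda>p. (x p + y p) / 2)"
    using face_subset_cubing_point[OF F midpoint_in_face[OF F xF yF]] .
  have "0 < x p" "0 < y q" "0 \<le> y p" "0 \<le> x q"
    using depth_pos_imp_pos[OF x pq(1,4)] depth_pos_imp_pos[OF y pq(2,5)]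
      cubing_point_nonneg[OF x, of q] cubing_point_nonneg[OF y, of p] by auto
  then have False using cubing_point_exclusive[OF m pq(1-3)] by simp
  then show "depth x p + depth y q \<le> linf_dist B x y" ..
qed

lemma profiles_within_chain_length:
  assumes "cubing_point x" and "L \<in> chain_lengths w B x y"
  shows "profiles_within L (depth x) (depth y)"
  using assms(2)
proof (induction rule: chain_lengths_induct)
  case refl
  then show ?case using profiles_within_depth_refl assms(1) by blast
next
  case (step K y z F)
  then show ?case using profiles_within_triangle profiles_within_on_face by blast
qed

section \<open>The chain metric in terms of depths\<close>

text \<open>
  Connectedness of the cubing is the case of \<open>short_chain_between_clips\<close> with a bound that all depths
  satisfy.
\<close>

lemma chain_lengths_nonempty:
  assumes x: "cubing_point x" and y: "cubing_point y"
  shows "chain_lengths w B x y \<noteq> {}"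
proof -
  have "profiles_within (2 * sum w movable) (depth x) (depth y)"
    unfolding profiles_within_def
  proof (intro conjI ballI impI)
    fix p q
    note b = depth_le_total_weight[OF x, of p] depth_le_total_weight[OF y, of p]
      depth_le_total_weight[OF y, of q] depth_nonneg[of x p] depth_nonneg[of y p]
    show "\<bar>depth x p - depth y p\<bar> \<le> 2 * sum w movable" "depth x p + depth y q \<le> 2 * sum w movable"
      using b by linarith+
  qed
  from short_chain_between_clips[OF profile_depth[OF x] profile_depth[OF y]
      profiles_within_depth_refl[OF x] profiles_within_depth_refl[OF y] this]
  show ?thesis using clip_depth x y by auto
qed

lemma chain_lengths_bdd_below: "cubing_point x \<Longrightarrow> bdd_below (chain_lengths w B x y)"
  using profiles_within_nonneg[OF profiles_within_chain_length] by (rule bdd_belowI)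

lemma cubing_dist_eq_Inf:
  "cubing_point x \<Longrightarrow> cubing_point y \<Longrightarrow> cubing_dist w B x y = Inf (chain_lengths w B x y)"
  unfolding cubing_dist_def by (simp add: mem_cubing_iff)

lemma cubing_dist_le:
  assumes "cubing_point x" "cubing_point y" "L \<in> chain_lengths w B x y"
  shows "cubing_dist w B x y \<le> L"
  using assms chain_lengths_bdd_below cubing_dist_eq_Inf by (simp add: cInf_lower)

lemma profiles_within_cubing_dist:
  assumes x: "cubing_point x" and y: "cubing_point y"
  shows "profiles_within (cubing_dist w B x y) (depth x) (depth y)"
  unfolding profiles_within_def cubing_dist_eq_Inf[OF x y]
  using profiles_within_abs[OF profiles_within_chain_length[OF x]]
    profiles_within_opposite[OF profiles_within_chain_length[OF x]]
  by (intro conjI ballI impI cInf_greatest chain_lengths_nonempty[OF x y]) blast+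

lemma cubing_dist_clip_le:
  assumes "profile u" "profile v" "profiles_within 0 u u" "profiles_within 0 v v" "profiles_within e u v"
  shows "cubing_dist w B (clip u) (clip v) \<le> e"
  using short_chain_between_clips[OF assms] cubing_dist_le cubing_point_clip assms order_trans by metis

text \<open>
  Together with \<open>profiles_within_cubing_dist\<close> this describes the chain metric completely: the distance
  is the least \<open>e\<close> for which the depths satisfy \<open>profiles_within e\<close>.
\<close>

lemma cubing_dist_le_if_profiles_within:
  assumes x: "cubing_point x" and y: "cubing_point y" and "profiles_within e (depth x) (depth y)"
  shows "cubing_dist w B x y \<le> e"
  using cubing_dist_clip_le[OF profile_depth[OF x] profile_depth[OF y]
      profiles_within_depth_refl[OF x] profiles_within_depth_refl[OF y] assms(3)] clip_depth x y by simp

lemma Metric_space_cubing: "Metric_space (cubing w B) (cubing_dist w B)"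
proof
  fix x y
  show "0 \<le> cubing_dist w B x y"
  proof (cases "cubing_point x \<and> cubing_point y")
    case True
    then show ?thesis using profiles_within_nonneg[OF profiles_within_cubing_dist] by blast
  next
    case False
    then show ?thesis unfolding cubing_dist_def by (auto simp: mem_cubing_iff)
  qed
  have "chain_lengths w B x y = chain_lengths w B y x" using chain_lengths_commute by blast
  then show "cubing_dist w B x y = cubing_dist w B y x" unfolding cubing_dist_def by auto
next
  fix x y assume "x \<in> cubing w B" "y \<in> cubing w B"
  then have x: "cubing_point x" and y: "cubing_point y" by (simp_all add: mem_cubing_iff)
  show "cubing_dist w B x y = 0 \<longleftrightarrow> x = y"
  proof
    assume "cubing_dist w B x y = 0"
    then have "depth x p = depth y p" if "p \<in> B" for p
      using profiles_within_abs[OF profiles_within_cubing_dist[OF x y] that] by simp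
    then have "clip (depth x) = clip (depth y)" by (simp add: clip_def fun_eq_iff)
    then show "x = y" using clip_depth x y by simp
  next
    assume "x = y"
    then show "cubing_dist w B x y = 0"
      using cubing_dist_le_if_profiles_within[OF x x profiles_within_depth_refl[OF x]]
        profiles_within_nonneg[OF profiles_within_cubing_dist[OF x x]] by simp
  qed
next
  fix x y z assume "x \<in> cubing w B" "y \<in> cubing w B" "z \<in> cubing w B"
  then have "cubing_point x" "cubing_point y" "cubing_point z" by (simp_all add: mem_cubing_iff)
  then show "cubing_dist w B x z \<le> cubing_dist w B x y + cubing_dist w B y z"
    by (intro cubing_dist_le_if_profiles_within profiles_within_triangle[OF profiles_within_cubing_dist
          profiles_within_cubing_dist])
qed

section \<open>Extending nonexpansive maps\<close>

text \<open>
  McShane's formula \<open>G c p\<close> extends the depth of \<open>f a\<close> behind \<open>p\<close> from \<open>A\<close> to \<open>C\<close>. The conditions on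
  pairs of walls survive the supremum because they concern positive values only, and a positive value of
  \<open>G c p\<close> is approximated by terms in which \<open>f a\<close> has positive depth behind \<open>p\<close>.
\<close>

lemma nonexpansive_extension:
  assumes A: "Metric_space A dA" and C: "Metric_space C dC"
    and i: "isometric_embedding A dA C dC i"
    and f: "nonexpansive_map A dA (cubing w B) (cubing_dist w B) f"
    and ne: "A \<noteq> {}"
  shows "\<exists>F. nonexpansive_map C dC (cubing w B) (cubing_dist w B) F \<and> (\<forall>a\<in>A. F (i a) = f a)"
proof -
  have iC: "a \<in> A \<Longrightarrow> i a \<in> C" and iso: "a \<in> A \<Longrightarrow> b \<in> A \<Longrightarrow> dC (i a) (i b) = dA a b" for a b
    using i unfolding isometric_embedding_def by auto
  have fp: "a \<in> A \<Longrightarrow> cubing_point (f a)"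
    and fd: "a \<in> A \<Longrightarrow> b \<in> A \<Longrightarrow> cubing_dist w B (f a) (f b) \<le> dC (i a) (i b)" for a b
    using f iso unfolding nonexpansive_map_def by (auto simp: mem_cubing_iff)
  define G where "G c p = (SUP a\<in>A. depth (f a) p - dC (i a) c)" for c p
  have bdd: "bdd_above ((\<lambda>a. depth (f a) p - dC (i a) c) ` A)" for c p
  proof (rule bdd_aboveI2)
    fix a assume "a \<in> A"
    then show "depth (f a) p - dC (i a) c \<le> sum w movable"
      using depth_le_total_weight[OF fp, of a p] Metric_space.nonneg[OF C, of "i a" c] by linarith
  qed
  have lower: "depth (f a) p - dC (i a) c \<le> G c p" if "a \<in> A" for a c p
    unfolding G_def using bdd that by (rule cSUP_upper[rotated])
  have attained: "\<exists>a\<in>A. y < depth (f a) p - dC (i a) c" if "y < G c p" for y c p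
    using that less_cSUP_iff[OF ne bdd] unfolding G_def by blast
  have G_profile: "profile (G c)" for c
    unfolding profile_def
  proof (intro conjI ballI impI)
    fix p assume p: "p \<in> B" "p \<notin> movable"
    show "G c p \<le> 0"
    proof (rule ccontr)
      assume "\<not> G c p \<le> 0"
      then obtain a where a: "a \<in> A" "0 < depth (f a) p - dC (i a) c" using attained[of 0] by force
      then show False
        using profile_off[OF profile_depth[OF fp[OF a(1)]] p] Metric_space.nonneg[OF C, of "i a" c] by linarith
    qed
  next
    fix p q assume pq: "p \<in> B" "q \<in> B" "p \<preceq> q" "p \<noteq> q" "0 < G c q"
    show "w p + G c q \<le> G c p"
    proof (rule ccontr)
      assume "\<not> ?thesis"
      \<comment> \<open>the maximum with \<open>0\<close> makes the chosen term positive, so that nesting applies to it\<close>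
      then have "max 0 (G c p - w p) < G c q" using pq(5) by simp
      then obtain a where a: "a \<in> A" "max 0 (G c p - w p) < depth (f a) q - dC (i a) c"
        using attained by blast
      then have "0 < depth (f a) q" using Metric_space.nonneg[OF C, of "i a" c] by linarith
      from profile_nested[OF profile_depth[OF fp[OF a(1)]] pq(1-4) this]
      show False using a(2) lower[OF a(1), of p c] by linarith
    qed
  qed
  have G_within: "profiles_within (dC c c') (G c) (G c')" if c: "c \<in> C" "c' \<in> C" for c c'
    unfolding profiles_within_def
  proof (intro conjI ballI impI)
    fix p
    have le: "G c p \<le> G c' p + dC c c'" if c: "c \<in> C" "c' \<in> C" for c c'
      unfolding G_def[of c]
    proof (rule cSUP_least[OF ne])
      fix a assume a: "a \<in> A"
      show "depth (f a) p - dC (i a) c \<le> G c' p + dC c c'"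
        using lower[OF a, of p c'] Metric_space.triangle[OF C iC[OF a] c] by linarith
    qed
    show "\<bar>G c p - G c' p\<bar> \<le> dC c c'"
      using le[OF c] le[OF c(2,1)] Metric_space.commute[OF C, of c c'] by linarith
  next
    fix p q assume pq: "p \<in> B" "q \<in> B" "star p \<preceq> q" "0 < G c p" "0 < G c' q"
    show "G c p + G c' q \<le> dC c c'"
    proof (rule ccontr)
      assume "\<not> ?thesis"
      \<comment> \<open>choosing \<open>b\<close> after \<open>a\<close>, with a bound that depends on \<open>a\<close>, avoids splitting the excess over
        \<open>dC c c'\<close> between the two suprema\<close>
      then have "max 0 (dC c c' - G c' q) < G c p" using pq(4) by simp
      then obtain a where a: "a \<in> A" "max 0 (dC c c' - G c' q) < depth (f a) p - dC (i a) c"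
        using attained by blast
      then have "max 0 (dC c c' - (depth (f a) p - dC (i a) c)) < G c' q" using pq(5) by simp
      then obtain b where b: "b \<in> A"
        "max 0 (dC c c' - (depth (f a) p - dC (i a) c)) < depth (f b) q - dC (i b) c'"
        using attained by blast
      have "depth (f a) p + depth (f b) q \<le> cubing_dist w B (f a) (f b)"
        using profiles_within_opposite[OF profiles_within_cubing_dist[OF fp[OF a(1)] fp[OF b(1)]] pq(1-3)]
          a(2) b(2) Metric_space.nonneg[OF C, of "i a" c] Metric_space.nonneg[OF C, of "i b" c'] by linarith
      also have "\<dots> \<le> dC (i a) (i b)" using fd a b by blast
      also have "\<dots> \<le> dC (i a) c + dC c c' + dC (i b) c'"
        using Metric_space.triangle[OF C iC[OF a(1)] c(1) iC[OF b(1)]]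
          Metric_space.triangle[OF C c iC[OF b(1)]] Metric_space.commute[OF C, of "i b" c'] by linarith
      finally show False using b(2) by linarith
    qed
  qed
  have G_self: "profiles_within 0 (G c) (G c)" if "c \<in> C" for c
    using G_within[OF that that] Metric_space.zero[OF C that that] by simp
  define F where "F c = clip (G c)" for c
  have "F (i a) = f a" if a: "a \<in> A" for a
  proof -
    have "G (i a) p = depth (f a) p" if p: "p \<in> B" for p
    proof (rule antisym)
      show "G (i a) p \<le> depth (f a) p"
        unfolding G_def
      proof (rule cSUP_least[OF ne])
        fix b assume b: "b \<in> A"
        show "depth (f b) p - dC (i b) (i a) \<le> depth (f a) p"
          using profiles_within_abs[OF profiles_within_cubing_dist[OF fp[OF b] fp[OF a]] p] fd[OF b a] by linarith
      qed
      show "depth (f a) p \<le> G (i a) p"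
        using lower[OF a, of p "i a"] Metric_space.zero[OF C iC[OF a] iC[OF a]] by simp
    qed
    then have "clip (G (i a)) = clip (depth (f a))" by (simp add: clip_def fun_eq_iff)
    then show ?thesis using clip_depth[OF fp[OF a]] unfolding F_def by simp
  qed
  moreover have "nonexpansive_map C dC (cubing w B) (cubing_dist w B) F"
    unfolding nonexpansive_map_def F_def
    using cubing_point_clip[OF G_profile G_self] cubing_dist_clip_le[OF G_profile G_profile G_self G_self G_within]
    by (auto simp: mem_cubing_iff)
  ultimately show ?thesis by blast
qed

text \<open>
  This settles the extension from the empty space, where the supremum in McShane's formula is over the
  empty set.
\<close>

lemma nonexpansive_const:
  assumes "Metric_space C dC"
  shows "\<exists>F. nonexpansive_map C dC (cubing w B) (cubing_dist w B) F"
proof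
  have "cubing_point (\<lambda>_. 0)" using weight_nonneg unfolding cubing_point_def by simp
  then have z: "(\<lambda>_. 0) \<in> cubing w B" by (simp add: mem_cubing_iff)
  then show "nonexpansive_map C dC (cubing w B) (cubing_dist w B) (\<lambda>_ _. 0)"
    using Metric_space.zero[OF Metric_space_cubing z z] Metric_space.nonneg[OF assms]
    unfolding nonexpansive_map_def by simp
qed

end

theorem theorem1p5p1:
  fixes P :: "'p set" and le :: "'p \<Rightarrow> 'p \<Rightarrow> bool" and zero :: 'p and star :: "'p \<Rightarrow> 'p"
    and w :: "'p \<Rightarrow> real" and B :: "'p set"
  assumes "finite_piecewise_linf_cubing P le zero star w B"
  shows "injective_metric_space TYPE('a) TYPE('c)
           (poc_set.cubing P le zero star w B) (poc_set.cubing_dist P le zero star w B)"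
proof -
  interpret finite_piecewise_linf_cubing P le zero star w B by (rule assms)
  show ?thesis
    unfolding injective_metric_space_def
  proof (intro conjI allI impI)
    show "Metric_space (cubing w B) (cubing_dist w B)" by (rule Metric_space_cubing)
    fix A :: "'a set" and dA and C :: "'c set" and dC i f
    assume "Metric_space A dA" "Metric_space C dC" "isometric_embedding A dA C dC i"
      "nonexpansive_map A dA (cubing w B) (cubing_dist w B) f"
    then show "\<exists>F. nonexpansive_map C dC (cubing w B) (cubing_dist w B) F \<and> (\<forall>a\<in>A. F (i a) = f a)"
      using nonexpansive_extension nonexpansive_const by (cases "A = {}") blast+
  qed
qed

end
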